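(* Consider the planted submatrix problem with parameters $n \ge 1$, $\lambda \ge 0$, $\rho\in(0,1)$, and target $x = v_1$. (i) For any $0<r<1$ and integer $D \ge 1$, if $\lambda \le \frac{r}{D(D+1)} \min\{1, \frac{1}{\rho\sqrt n}\}$, then $\mathrm{MMSE}_{\le D} \ge \rho - \rho^2/(1-r^2)^2$. (ii) For any $0<r<1$ and odd integer $D\ge 1$, if \[ \lambda \ge \frac{24}{r}\sqrt{\log 8 + 2D\log(9/\rho)}\,\min\Big\{1,\frac{1}{\rho\sqrt n}\Big\} \quad\text{and}\quad \frac{324}{r^2 n}\big[\log 8 + 2D\log(9/\rho)\big] \le \rho \le 1/2, \] then $\mathrm{MMSE}_{\le D} \le D^2 r^{D-1}$.
   Context: Planted submatrix problem: observe the $n\times n$ matrix $Y = \lambda v v^\top + W$, where $v\in\{0,1\}^n$ has i.i.d. $\mathrm{Bernoulli}(\rho)$ entries, and $W$ is symmetric with $W_{ij}=W_{ji}\sim\mathcal{N}(0,1)$ for $i<j$, $W_{ii}\sim\mathcal{N}(0,2)$, the variables $\{W_{ij}: i\le j\}$ independent and independent of $v$. The parameters $\lambda,\rho$ are known. $\mathrm{MMSE}_{\le D} = \inf_{f} \mathbb{E}(f(Y)-x)^2$, infimum over real polynomials $f$ of degree at most $D$ in the entries of $Y$, expectation over the joint law of $(v,W)$. Logarithms are natural. *)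

theory Defs
  imports "HOL-Probability.Probability"
begin

text \<open>Planted submatrix model. Indices are 0-based: i, j range over {0..<n}.
  The outcome is a pair (v, z): v i = True iff the i-th entry of the planted vector is 1,
  z (i,j) for i \<le> j < n is the noise entry W_ij.\<close>

definition upper_pairs :: "nat \<Rightarrow> (nat \<times> nat) set" where
  "upper_pairs n = {(i,j). i \<le> j \<and> j < n}"

definition v_law :: "nat \<Rightarrow> real \<Rightarrow> (nat \<Rightarrow> bool) measure" where
  "v_law n \<rho> = PiM {0..<n} (\<lambda>_. measure_pmf (bernoulli_pmf \<rho>))"

text \<open>Law of the independent noise entries W_ij (i \<le> j): N(0,1) off the diagonal,
  N(0,2) on the diagonal (normal_density takes the standard deviation).\<close>
definition W_law :: "nat \<Rightarrow> (nat \<times> nat \<Rightarrow> real) measure" where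
  "W_law n = PiM (upper_pairs n)
     (\<lambda>(i,j). density lborel (normal_density 0 (if i = j then sqrt 2 else 1)))"

definition planted_space :: "nat \<Rightarrow> real \<Rightarrow> ((nat \<Rightarrow> bool) \<times> (nat \<times> nat \<Rightarrow> real)) measure" where
  "planted_space n \<rho> = v_law n \<rho> \<Otimes>\<^sub>M W_law n"

text \<open>The observation Y = lambda v v^T + W (W symmetric).\<close>
definition Yobs :: "real \<Rightarrow> (nat \<Rightarrow> bool) \<times> (nat \<times> nat \<Rightarrow> real) \<Rightarrow> nat \<times> nat \<Rightarrow> real" where
  "Yobs lam \<omega> p = lam * of_bool (fst \<omega> (fst p)) * of_bool (fst \<omega> (snd p))
       + snd \<omega> (min (fst p) (snd p), max (fst p) (snd p))"

definition monomials :: "nat \<Rightarrow> nat \<Rightarrow> (nat \<times> nat) multiset set" where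
  "monomials n D = {\<alpha>. set_mset \<alpha> \<subseteq> {0..<n} \<times> {0..<n} \<and> size \<alpha> \<le> D}"

definition polyval :: "nat \<Rightarrow> nat \<Rightarrow> ((nat \<times> nat) multiset \<Rightarrow> real) \<Rightarrow> (nat \<times> nat \<Rightarrow> real) \<Rightarrow> real" where
  "polyval n D c Y = (\<Sum>\<alpha>\<in>monomials n D. c \<alpha> * prod_mset (image_mset Y \<alpha>))"

text \<open>MMSE_{\<le>D} for the target x = v_1 (index 0), as the infimum over all degree \<le> D
  polynomials of E (f(Y) - x)^2 (nonnegative integral, valued in ennreal).\<close>
definition MMSE :: "nat \<Rightarrow> real \<Rightarrow> real \<Rightarrow> nat \<Rightarrow> ennreal" where
  "MMSE n lam \<rho> D = (INF c. \<integral>\<^sup>+ \<omega>. ennreal ((polyval n D c (Yobs lam \<omega>) - of_bool (fst \<omega> 0))\<^sup>2)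
                              \<partial>planted_space n \<rho>)"

end

theory Submission
  imports Defs "HOL-Computational_Algebra.Polynomial"
begin

text \<open>Lower bound. Let \<open>Z\<close> be the normalised noise and \<open>x = v\<^sub>1\<close>. There is a polynomial \<open>w(Z)\<close> in
  the noise alone with \<open>E[f(Y) x] = E[f(Y) w(Z)]\<close> for every polynomial \<open>f\<close> of degree at most \<open>D\<close>:
  its Hermite coefficients are the joint cumulants \<open>\<kappa>\<^sub>\<alpha>\<close> of \<open>x\<close> and the signal entries. Hence
  \<open>E(f(Y) - x)\<^sup>2 = E(f(Y) - w(Z))\<^sup>2 + E x\<^sup>2 - E w(Z)\<^sup>2\<close>, and it remains to bound
  \<open>E w(Z)\<^sup>2 = \<Sum> \<kappa>\<^sub>\<alpha>\<^sup>2 / \<alpha>!\<close>. Viewing \<open>\<alpha>\<close> as a multigraph, \<open>\<kappa>\<^sub>\<alpha>\<close> vanishes unless every component of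
  \<open>\<alpha>\<close> contains the target vertex, so that a nonzero \<open>\<kappa>\<^sub>\<alpha>\<close> with \<open>d\<close> edges involves at most \<open>d\<close>
  other vertices; the sum is then controlled by counting.

  Upper bound. The diagonal entry \<open>Y\<^sub>1\<^sub>1\<close>, or the sum of the first row, is after normalisation within
  a small error \<open>T\<close> of \<open>v\<^sub>1\<close>. Applying a majority polynomial of degree \<open>D\<close> to it sharpens the error
  to order \<open>|T|^((D+1)/2)\<close>, whose second moment is bounded by the moment generating function of \<open>T\<close>.\<close>

section \<open>Joint cumulants of the signal\<close>

text \<open>The obstacle is that Hermite polynomials in \<open>Y\<close> are not orthogonal under
  the planted law, so the best polynomial cannot be read off from a diagonal Gram matrix. In the
  noise they are orthogonal, which is why \<open>w\<close> is sought as a function of the noise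
  only. A Hermite polynomial in \<open>Y\<close> expands by a binomial shift formula into Hermite
  polynomials in \<open>Z\<close> of smaller index, so matching correlations is a triangular linear
  system, and solving it is exactly the moment-cumulant recursion. The factor D(D+1) comes from two
  d-th powers: a cumulant with d edges is at most d^d times a power of \<rho>, and d edges can be
  placed on h+1 vertices in at most (h+1)^(2d) ways, with h \<le> d. Each further vertex costs n in
  the count and gains \<rho>^2 in the square, hence the comparison of \<rho> sqrt n with 1. For the
  upper bound, the statistic is unbounded, so the majority polynomial has to be controlled on the
  whole real line and not only on [0,1]; domination by exponentials does this and leaves a moment
  generating function at one point of each sign.\<close>

definition multi_index :: "'e set \<Rightarrow> ('e \<Rightarrow> nat) set" where
  "multi_index E = {\<alpha>. \<forall>e. e \<notin> E \<longrightarrow> \<alpha> e = 0}"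

lemma multi_indexD: "\<alpha> \<in> multi_index E \<Longrightarrow> e \<notin> E \<Longrightarrow> \<alpha> e = 0"
  by (simp add: multi_index_def)

definition multi_choose :: "'e set \<Rightarrow> ('e \<Rightarrow> nat) \<Rightarrow> ('e \<Rightarrow> nat) \<Rightarrow> real" where
  "multi_choose E \<alpha> \<beta> = (\<Prod>e\<in>E. real (\<alpha> e choose \<beta> e))"

lemma below_multi_index:
  assumes "\<alpha> \<in> multi_index E"
  shows "{\<beta>. \<beta> \<le> \<alpha>} = PiE_dflt E 0 (\<lambda>e. {..\<alpha> e})"
  using assms by (auto simp: PiE_dflt_def multi_index_def le_fun_def) (metis le_zero_eq, metis le0)

lemma finite_below_multi_index:
  assumes "finite E" "\<alpha> \<in> multi_index E"
  shows "finite {\<beta>. \<beta> \<le> \<alpha>}"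
  unfolding below_multi_index[OF assms(2)] using assms(1) by (intro finite_PiE_dflt) auto

lemma multi_index_le: "\<alpha> \<in> multi_index E \<Longrightarrow> \<beta> \<le> \<alpha> \<Longrightarrow> \<beta> \<in> multi_index E"
  by (auto simp: multi_index_def le_fun_def) (metis le_zero_eq)

lemma sum_multi_index_less:
  assumes "finite E" "\<alpha> \<in> multi_index E" "\<beta> \<le> \<alpha>" "\<beta> \<noteq> \<alpha>"
  shows "sum \<beta> E < sum \<alpha> E"
proof -
  obtain e where e: "\<beta> e \<noteq> \<alpha> e" using assms(4) by auto
  then have "e \<in> E" using assms(2) multi_index_le[OF assms(2,3)]
    by (auto simp: multi_index_def) metis
  moreover have "\<beta> e < \<alpha> e" using e assms(3) by (auto simp: le_fun_def order_less_le)
  ultimately show ?thesis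
    using assms(1,3) by (intro sum_strict_mono_ex1) (auto simp: le_fun_def)
qed

lemma prod_sum_below:
  fixes f :: "'e \<Rightarrow> nat \<Rightarrow> 'a::comm_semiring_1"
  assumes "finite E" "\<alpha> \<in> multi_index E"
  shows "(\<Prod>e\<in>E. \<Sum>b\<le>\<alpha> e. f e b) = (\<Sum>\<beta> | \<beta> \<le> \<alpha>. \<Prod>e\<in>E. f e (\<beta> e))"
proof -
  have "(\<Prod>e\<in>E. \<Sum>b\<le>\<alpha> e. f e b) = (\<Sum>g\<in>PiE E (\<lambda>e. {..\<alpha> e}). \<Prod>e\<in>E. f e (g e))"
    by (rule prod_sum_PiE) (use assms in auto)
  also have "\<dots> = (\<Sum>\<beta>\<in>PiE_dflt E 0 (\<lambda>e. {..\<alpha> e}). \<Prod>e\<in>E. f e (\<beta> e))"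
    unfolding restrict_PiE_dflt[of E 0, symmetric]
    by (subst sum.reindex) (auto simp: inj_on_def fun_eq_iff PiE_dflt_def restrict_def, metis)
  finally show ?thesis by (simp only: below_multi_index[OF assms(2)])
qed

text \<open>The binomial theorem in every coordinate. \<open>cumul_bound\<close> uses it at
  \<open>t = d - 1\<close>, where the right-hand side becomes \<open>d ^ d\<close>.\<close>

lemma sum_multi_choose_power:
  assumes "finite E" "\<alpha> \<in> multi_index E"
  shows "(\<Sum>\<beta> | \<beta> \<le> \<alpha>. multi_choose E \<alpha> \<beta> * t ^ sum \<beta> E) = (1 + t) ^ sum \<alpha> E"
proof -
  have "(1 + t) ^ sum \<alpha> E = (\<Prod>e\<in>E. \<Sum>b\<le>\<alpha> e. real (\<alpha> e choose b) * t ^ b)"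
    by (simp add: power_sum binomial_ring[of t 1, simplified add.commute[of t]])
  also have "\<dots> = (\<Sum>\<beta> | \<beta> \<le> \<alpha>. multi_choose E \<alpha> \<beta> * t ^ sum \<beta> E)"
    by (simp add: prod_sum_below[OF assms] multi_choose_def prod.distrib power_sum)
  finally show ?thesis by simp
qed

lemma multi_choose_nonneg: "0 \<le> multi_choose E \<alpha> \<beta>"
  by (auto simp: multi_choose_def intro!: prod_nonneg)

lemma multi_choose_zero: "multi_choose E \<alpha> (\<lambda>_. 0) = 1"
  by (simp add: multi_choose_def)

lemma multi_choose_self: "multi_choose E \<alpha> \<alpha> = 1"
  by (simp add: multi_choose_def)

section \<open>Multigraphs and the moment-cumulant recursion\<close>

text \<open>A multi-index is read as a multigraph in which \<open>\<alpha> e\<close> is the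
  multiplicity of the edge \<open>e\<close>, loops allowed. Signal entries are products of 0/1
  variables, so a signal moment depends on \<open>\<alpha>\<close> only through this vertex
  set.\<close>

definition verts :: "(nat \<times> nat \<Rightarrow> nat) \<Rightarrow> nat set" where
  "verts \<alpha> = (\<Union>e\<in>{e. \<alpha> e > 0}. {fst e, snd e})"

lemma finite_verts:
  assumes "finite E" "\<alpha> \<in> multi_index E" shows "finite (verts \<alpha>)"
proof -
  have "{e. \<alpha> e > 0} \<subseteq> E" using assms(2) by (auto simp: multi_index_def) (metis less_irrefl)
  then have "finite {e. \<alpha> e > 0}" using assms(1) finite_subset by blast
  then show ?thesis by (simp add: verts_def)
qed

lemma verts_zero [simp]: "verts (\<lambda>_. 0) = {}" by (simp add: verts_def)

text \<open>With \<open>X\<^sub>e = v\<^sub>i v\<^sub>j\<close> and \<open>x = v\<^sub>0\<close> the moments are \<open>E[x X\<^sup>\<alpha>] = \<rho>^|V(\<alpha>) \<union> {0}|\<close> and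
  \<open>E[X\<^sup>\<alpha>] = \<rho>^|V(\<alpha>)|\<close>, so this is the recursion for the joint cumulants with generating function
  \<open>E[x exp(tX)] / E[exp(tX)]\<close>.\<close>

function cumul :: "(nat \<times> nat) set \<Rightarrow> real \<Rightarrow> (nat \<times> nat \<Rightarrow> nat) \<Rightarrow> real" where
  "cumul E \<rho> \<alpha> = \<rho> ^ card (insert 0 (verts \<alpha>)) -
     (\<Sum>\<beta> | finite E \<and> \<alpha> \<in> multi_index E \<and> \<beta> \<le> \<alpha> \<and> \<beta> \<noteq> \<alpha>.
        multi_choose E \<alpha> \<beta> * cumul E \<rho> \<beta> * \<rho> ^ card (verts (\<lambda>e. \<alpha> e - \<beta> e)))"
  by auto
termination
  \<comment> \<open>The guards \<open>finite E\<close> and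
    \<open>\<alpha> \<in> multi_index E\<close> in the recursive sum serve this measure: under them
    a proper sub-index has strictly smaller total, and otherwise the sum is empty.\<close>
  by (relation "Wellfounded.measure (\<lambda>(E, \<rho>, \<alpha>). sum \<alpha> E)") (auto intro: sum_multi_index_less)

declare cumul.simps [simp del]

text \<open>The recursion with the term \<open>\<beta> = \<alpha>\<close> moved back into the sum:
  the triangular system that the dual certificate has to solve.\<close>

lemma cumul_moment:
  assumes "finite E" "\<alpha> \<in> multi_index E"
  shows "(\<Sum>\<beta> | \<beta> \<le> \<alpha>. multi_choose E \<alpha> \<beta> * cumul E \<rho> \<beta> * \<rho> ^ card (verts (\<lambda>e. \<alpha> e - \<beta> e)))
    = \<rho> ^ card (insert 0 (verts \<alpha>))"
proof -
  have "{\<beta>. \<beta> \<le> \<alpha>} = insert \<alpha> {\<beta>. \<beta> \<le> \<alpha> \<and> \<beta> \<noteq> \<alpha>}" by auto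
  moreover have "finite {\<beta>. \<beta> \<le> \<alpha> \<and> \<beta> \<noteq> \<alpha>}"
    by (rule finite_subset[OF _ finite_below_multi_index[OF assms]]) auto
  ultimately show ?thesis
    using assms by (simp add: multi_choose_self cumul.simps[of E \<rho> \<alpha>])
qed

lemma verts_subset: "\<beta> \<le> \<alpha> \<Longrightarrow> verts \<alpha> \<subseteq> verts \<beta> \<union> verts (\<lambda>e. \<alpha> e - \<beta> e)"
proof
  fix i assume le: "\<beta> \<le> \<alpha>" and "i \<in> verts \<alpha>"
  then obtain e where e: "\<alpha> e > 0" "i \<in> {fst e, snd e}" by (auto simp: verts_def)
  then have "\<beta> e > 0 \<or> \<alpha> e - \<beta> e > 0" using le by (auto simp: le_fun_def)
  with e show "i \<in> verts \<beta> \<union> verts (\<lambda>e. \<alpha> e - \<beta> e)" unfolding verts_def by blast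
qed

lemma multi_index_diff: "\<alpha> \<in> multi_index E \<Longrightarrow> (\<lambda>e. \<alpha> e - \<beta> e) \<in> multi_index E"
  by (auto simp: multi_index_def)

text \<open>Strong induction on the number d of edges. The vertices of a subgraph and of its
  complement together cover those of \<open>\<alpha>\<close>, so each term of the recursion is at
  most \<open>\<rho> ^ c0\<close> times a combinatorial factor. Replacing the base
  \<open>sum \<beta> E\<close> by \<open>d - 1\<close> in the induction hypothesis turns these
  factors into one multi-binomial sum.\<close>

lemma cumul_bound:
  assumes "finite E" "\<alpha> \<in> multi_index E" "0 < \<rho>" "\<rho> < 1"
  shows "\<bar>cumul E \<rho> \<alpha>\<bar> \<le> real (sum \<alpha> E) ^ sum \<alpha> E * \<rho> ^ card (insert 0 (verts \<alpha>))"
  using assms(2)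
proof (induction "sum \<alpha> E" arbitrary: \<alpha> rule: less_induct)
  case less
  note \<alpha> = less.prems
  define d where "d = sum \<alpha> E"
  define c0 where "c0 = card (insert 0 (verts \<alpha>))"
  define g where "g \<beta> = multi_choose E \<alpha> \<beta> * cumul E \<rho> \<beta> * \<rho> ^ card (verts (\<lambda>e. \<alpha> e - \<beta> e))" for \<beta>
  let ?z = "\<lambda>_. 0 :: nat"
  have c0z: "cumul E \<rho> ?z = \<rho>"
  proof -
    have "{\<beta>. \<beta> \<le> ?z} = {?z :: nat \<times> nat \<Rightarrow> nat}" by (auto simp: le_fun_def)
    then show ?thesis
      using cumul_moment[OF assms(1), of ?z \<rho>] by (simp add: multi_index_def multi_choose_zero)
  qed
  show ?case
  proof (cases "\<alpha> = ?z")
    case True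
    then show ?thesis using c0z assms by simp
  next
    case False
    \<comment> \<open>The index 0 is kept out of \<open>B\<close>: its term is paired with the
      leading moment, because the difference of the two still lies between 0 and
      \<open>\<rho> ^ c0\<close>.\<close>
    define B where "B = {\<beta>. \<beta> \<le> \<alpha> \<and> \<beta> \<noteq> \<alpha> \<and> \<beta> \<noteq> ?z}"
    have z_le: "?z \<le> \<alpha>" by (simp add: le_fun_def)
    have fin: "finite {\<beta>. \<beta> \<le> \<alpha>}" by (rule finite_below_multi_index[OF assms(1) \<alpha>])
    have finB: "finite B" by (rule finite_subset[OF _ fin]) (auto simp: B_def)
    have split: "{\<beta>. \<beta> \<le> \<alpha>} = insert \<alpha> (insert ?z B)" using z_le by (auto simp: B_def)
    have notin: "?z \<notin> B" "\<alpha> \<notin> insert ?z B" using False by (auto simp: B_def)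
    have S: "(\<Sum>\<beta> | \<beta> \<le> \<alpha>. F \<beta>) = F \<alpha> + (F ?z + (\<Sum>\<beta>\<in>B. F \<beta>))" for F :: "_ \<Rightarrow> real"
      unfolding split using finB notin by simp
    have k: "cumul E \<rho> \<alpha> = (\<rho> ^ c0 - \<rho> * \<rho> ^ card (verts \<alpha>)) - (\<Sum>\<beta>\<in>B. g \<beta>)"
      using cumul_moment[OF assms(1) \<alpha>, of \<rho>, unfolded S]
      by (simp add: multi_choose_self multi_choose_zero g_def c0_def c0z)
    have finV: "finite (verts \<alpha>)" by (rule finite_verts[OF assms(1) \<alpha>])
    have "c0 \<le> Suc (card (verts \<alpha>))" unfolding c0_def by (rule card_insert_le_m1) auto
    then have "\<rho> ^ Suc (card (verts \<alpha>)) \<le> \<rho> ^ c0" using assms by (intro power_decreasing) auto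
    then have h1: "\<bar>\<rho> ^ c0 - \<rho> * \<rho> ^ card (verts \<alpha>)\<bar> \<le> \<rho> ^ c0"
      using assms by simp
    obtain e where "\<alpha> e \<noteq> 0" using False by blast
    then have "e \<in> E" "\<alpha> e > 0" using multi_indexD[OF \<alpha>, of e] by auto
    then have d1: "d \<ge> 1" using member_le_sum[of e E \<alpha>] assms(1) by (simp add: d_def)
    have g: "\<bar>g \<beta>\<bar> \<le> multi_choose E \<alpha> \<beta> * real (d - 1) ^ sum \<beta> E * \<rho> ^ c0" if "\<beta> \<in> B" for \<beta>
    proof -
      have b: "\<beta> \<le> \<alpha>" "\<beta> \<noteq> \<alpha>" using that by (auto simp: B_def)
      have lt: "sum \<beta> E < d" unfolding d_def by (rule sum_multi_index_less[OF assms(1) \<alpha> b])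
      have bm: "\<beta> \<in> multi_index E" by (rule multi_index_le[OF \<alpha> b(1)])
      have "\<bar>cumul E \<rho> \<beta>\<bar> \<le> real (sum \<beta> E) ^ sum \<beta> E * \<rho> ^ card (insert 0 (verts \<beta>))"
        using less.hyps[OF _ bm] lt by (simp add: d_def)
      also have "\<dots> \<le> real (d - 1) ^ sum \<beta> E * \<rho> ^ card (insert 0 (verts \<beta>))"
      proof (rule mult_right_mono[OF power_mono])
        have "sum \<beta> E \<le> d - 1" using lt by linarith
        then show "real (sum \<beta> E) \<le> real (d - 1)" by (rule of_nat_mono)
      qed (use assms in \<open>auto simp del: of_nat_sum\<close>)
      finally have 1: "\<bar>cumul E \<rho> \<beta>\<bar> \<le> \<dots>" .
      have "insert 0 (verts \<alpha>) \<subseteq> insert 0 (verts \<beta>) \<union> verts (\<lambda>e. \<alpha> e - \<beta> e)"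
        using verts_subset[OF b(1)] by auto
      then have "c0 \<le> card (insert 0 (verts \<beta>) \<union> verts (\<lambda>e. \<alpha> e - \<beta> e))"
        unfolding c0_def using finite_verts[OF assms(1) bm]
          finite_verts[OF assms(1) multi_index_diff[OF \<alpha>]] by (intro card_mono) auto
      also have "\<dots> \<le> card (insert 0 (verts \<beta>)) + card (verts (\<lambda>e. \<alpha> e - \<beta> e))" by (rule card_Un_le)
      finally have "\<rho> ^ (card (insert 0 (verts \<beta>)) + card (verts (\<lambda>e. \<alpha> e - \<beta> e))) \<le> \<rho> ^ c0"
        using assms by (intro power_decreasing) auto
      note 2 = this[unfolded power_add]
      have "\<bar>g \<beta>\<bar> = multi_choose E \<alpha> \<beta> * (\<bar>cumul E \<rho> \<beta>\<bar> * \<rho> ^ card (verts (\<lambda>e. \<alpha> e - \<beta> e)))"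
        using assms by (simp add: g_def abs_mult multi_choose_nonneg)
      also have "\<dots> \<le> multi_choose E \<alpha> \<beta> * (real (d - 1) ^ sum \<beta> E * \<rho> ^ card (insert 0 (verts \<beta>)) * \<rho> ^ card (verts (\<lambda>e. \<alpha> e - \<beta> e)))"
        using 1 assms by (intro mult_left_mono mult_right_mono multi_choose_nonneg) auto
      also have "\<dots> = multi_choose E \<alpha> \<beta> * real (d - 1) ^ sum \<beta> E * (\<rho> ^ card (insert 0 (verts \<beta>)) * \<rho> ^ card (verts (\<lambda>e. \<alpha> e - \<beta> e)))"
        by simp
      also have "\<dots> \<le> multi_choose E \<alpha> \<beta> * real (d - 1) ^ sum \<beta> E * \<rho> ^ c0"
        using 2 by (intro mult_left_mono mult_nonneg_nonneg multi_choose_nonneg) auto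
      finally show ?thesis .
    qed
    \<comment> \<open>This is (1 + (d - 1))^d expanded. Without the terms of \<open>\<alpha>\<close>
      and 0 at most \<open>d ^ d - 1\<close> remains, and the missing 1 pays for the leading term
      \<open>h1\<close>.\<close>
    have "real d ^ d = real (d - 1) ^ d + 1 + (\<Sum>\<beta>\<in>B. multi_choose E \<alpha> \<beta> * real (d - 1) ^ sum \<beta> E)"
      using sum_multi_choose_power[OF assms(1) \<alpha>, of "real (d - 1)", unfolded S] d1
      by (simp add: multi_choose_self multi_choose_zero d_def[symmetric] of_nat_diff)
    then have sumB: "(\<Sum>\<beta>\<in>B. multi_choose E \<alpha> \<beta> * real (d - 1) ^ sum \<beta> E) \<le> real d ^ d - 1"
      by simp
    have "\<bar>\<Sum>\<beta>\<in>B. g \<beta>\<bar> \<le> (\<Sum>\<beta>\<in>B. multi_choose E \<alpha> \<beta> * real (d - 1) ^ sum \<beta> E) * \<rho> ^ c0"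
      unfolding sum_distrib_right by (rule order_trans[OF sum_abs sum_mono[OF g]])
    also have "\<dots> \<le> (real d ^ d - 1) * \<rho> ^ c0" using sumB assms by (intro mult_right_mono) auto
    finally show ?thesis using k h1 unfolding d_def[symmetric] c0_def[symmetric]
      by (simp add: algebra_simps)
  qed
qed

text \<open>The part of the graph inside \<open>T\<close> is independent of the rest and of the target.\<close>

lemma cumul_disconnected:
  assumes E: "finite E" and T0: "0 \<notin> T" and \<alpha>: "\<alpha> \<in> multi_index E"
    and nocross: "\<And>e. \<alpha> e > 0 \<Longrightarrow> fst e \<in> T \<longleftrightarrow> snd e \<in> T"
    and ex: "\<exists>e. \<alpha> e > 0 \<and> fst e \<in> T"
  shows "cumul E \<rho> \<alpha> = 0"
  using \<alpha> nocross ex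
proof (induction "sum \<alpha> E" arbitrary: \<alpha> rule: less_induct)
  case less
  note \<alpha> = less.prems(1) and nc = less.prems(2) and ex = less.prems(3)
  define a where "a = (\<lambda>e. if fst e \<in> T then 0 else \<alpha> e)"
  define b where "b = (\<lambda>e. if fst e \<in> T then \<alpha> e else 0)"
  have a_le: "a \<le> \<alpha>" and am: "a \<in> multi_index E" and bm: "b \<in> multi_index E"
    using \<alpha> by (auto simp: a_def b_def le_fun_def multi_index_def)
  have a_ne: "a \<noteq> \<alpha>" using ex by (auto simp: a_def fun_eq_iff)
  have fin: "finite {\<beta>. \<beta> \<le> \<alpha>}" by (rule finite_below_multi_index[OF E \<alpha>])
  define F where "F \<beta> = multi_choose E \<alpha> \<beta> * cumul E \<rho> \<beta> * \<rho> ^ card (verts (\<lambda>e. \<alpha> e - \<beta> e))" for \<beta>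
  \<comment> \<open>Such a \<open>\<beta>\<close> still has an edge inside \<open>T\<close> and
    inherits the absence of crossing edges, so the induction hypothesis applies to it.\<close>
  have zero: "F \<beta> = 0" if \<beta>: "\<beta> \<le> \<alpha>" "\<beta> \<noteq> \<alpha>" "\<not> \<beta> \<le> a" for \<beta>
  proof -
    obtain e where e: "\<not> \<beta> e \<le> a e" using \<beta>(3) unfolding le_fun_def by blast
    have "fst e \<in> T" using e le_funD[OF \<beta>(1), of e] by (auto simp: a_def split: if_splits)
    then have "\<exists>e. \<beta> e > 0 \<and> fst e \<in> T" using e by (intro exI[of _ e]) (auto simp: a_def)
    moreover have "fst e \<in> T \<longleftrightarrow> snd e \<in> T" if "\<beta> e > 0" for e
      using nc less_le_trans[OF that le_funD[OF \<beta>(1)]] .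
    ultimately have "cumul E \<rho> \<beta> = 0"
      using less.hyps[OF sum_multi_index_less[OF E \<alpha> \<beta>(1,2)] multi_index_le[OF \<alpha> \<beta>(1)]] by blast
    then show ?thesis by (simp add: F_def)
  qed
  have vb: "verts b \<subseteq> T" using nc by (auto simp: verts_def b_def split: if_splits)
  have va: "verts \<beta> \<inter> T = {}" if "\<beta> \<le> a" for \<beta>
  proof -
    have "fst e \<notin> T \<and> snd e \<notin> T" if "\<beta> e > 0" for e
    proof -
      have "a e > 0" using that \<open>\<beta> \<le> a\<close> by (metis le_funD less_le_trans)
      then show ?thesis using nc[of e] by (auto simp: a_def split: if_splits)
    qed
    then show ?thesis by (auto simp: verts_def)
  qed
  \<comment> \<open>For \<open>\<beta> \<le> a\<close> the whole part \<open>b\<close> stays in the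
    complement, and it shares no vertex with \<open>a\<close>; its moment therefore factors
    out.\<close>
  have eqF: "F \<beta> = \<rho> ^ card (verts b) * (multi_choose E a \<beta> * cumul E \<rho> \<beta> * \<rho> ^ card (verts (\<lambda>e. a e - \<beta> e)))"
    if "\<beta> \<le> a" for \<beta>
  proof -
    have "\<beta> e = 0" if "fst e \<in> T" for e using le_funD[OF \<open>\<beta> \<le> a\<close>, of e] that by (simp add: a_def)
    then have 1: "multi_choose E \<alpha> \<beta> = multi_choose E a \<beta>"
      unfolding multi_choose_def by (intro prod.cong) (auto simp: a_def)
    have "(\<lambda>e. a e - \<beta> e) \<le> a" by (auto simp: le_fun_def)
    from va[OF this] vb have disj: "verts (\<lambda>e. a e - \<beta> e) \<inter> verts b = {}" by auto
    have "0 < \<alpha> e - \<beta> e \<longleftrightarrow> 0 < a e - \<beta> e \<or> 0 < b e" for e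
      using \<open>\<And>e. fst e \<in> T \<Longrightarrow> \<beta> e = 0\<close> by (auto simp: a_def b_def)
    then have "verts (\<lambda>e. \<alpha> e - \<beta> e) = verts (\<lambda>e. a e - \<beta> e) \<union> verts b"
      unfolding verts_def by auto
    then have "card (verts (\<lambda>e. \<alpha> e - \<beta> e)) = card (verts (\<lambda>e. a e - \<beta> e)) + card (verts b)"
      using disj finite_verts[OF E bm] finite_verts[OF E multi_index_diff[OF am]]
      by (simp add: card_Un_disjoint)
    then show ?thesis by (simp add: F_def 1 power_add)
  qed
  have va': "verts \<alpha> = verts a \<union> verts b"
  proof -
    have "0 < \<alpha> e \<longleftrightarrow> 0 < a e \<or> 0 < b e" for e by (simp add: a_def b_def)
    then show ?thesis unfolding verts_def by auto
  qed
  have "insert 0 (verts a) \<inter> verts b = {}" using va[of a] vb T0 by auto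
  then have card0: "card (insert 0 (verts \<alpha>)) = card (insert 0 (verts a)) + card (verts b)"
    using finite_verts[OF E bm] finite_verts[OF E am] card_Un_disjoint[of "insert 0 (verts a)" "verts b"]
    by (simp add: va')
  have sub: "insert \<alpha> {\<beta>. \<beta> \<le> a} \<subseteq> {\<beta>. \<beta> \<le> \<alpha>}" using a_le by auto
  \<comment> \<open>Only \<open>\<alpha>\<close> itself and the indices below \<open>a\<close>
    contribute. The latter already add up to the full moment, which factors in the same way, so
    nothing is left for \<open>\<alpha>\<close>.\<close>
  have "\<rho> ^ card (insert 0 (verts \<alpha>)) = (\<Sum>\<beta> | \<beta> \<le> \<alpha>. F \<beta>)"
    using cumul_moment[OF E \<alpha>, of \<rho>] by (simp add: F_def)
  also have "\<dots> = (\<Sum>\<beta>\<in>insert \<alpha> {\<beta>. \<beta> \<le> a}. F \<beta>)"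
    by (rule sum.mono_neutral_right[OF fin sub]) (use zero in auto)
  also have "\<dots> = F \<alpha> + (\<Sum>\<beta> | \<beta> \<le> a. F \<beta>)"
    using finite_below_multi_index[OF E am] a_ne a_le by (subst sum.insert) auto
  also have "(\<Sum>\<beta> | \<beta> \<le> a. F \<beta>) = \<rho> ^ card (verts b) * \<rho> ^ card (insert 0 (verts a))"
    unfolding cumul_moment[OF E am, symmetric] sum_distrib_left by (intro sum.cong) (auto simp: eqF)
  also have "F \<alpha> = cumul E \<rho> \<alpha>" by (simp add: F_def multi_choose_self)
  finally show ?case by (simp add: card0 power_add)
qed

section \<open>Vertex counts and numbers of multigraphs\<close>

text \<open>Connectivity is phrased through cuts, the form in which
  \<open>cumul_disconnected\<close> supplies it. Take a largest edge set \<open>G\<close> that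
  reaches at most \<open>card G + 1\<close> vertices. An edge leaving its vertex set would add one
  edge and one vertex, contradicting maximality; so the complement is a cut, and all edges lie
  inside.\<close>

lemma card_vertices_connected_le:
  fixes F :: "('v \<times> 'v) set"
  assumes "finite F"
    and conn: "\<And>T. r \<notin> T \<Longrightarrow> (\<And>e. e \<in> F \<Longrightarrow> fst e \<in> T \<longleftrightarrow> snd e \<in> T) \<Longrightarrow> (\<And>e. e \<in> F \<Longrightarrow> fst e \<notin> T)"
  shows "card (insert r (\<Union>e\<in>F. {fst e, snd e})) \<le> card F + 1"
proof -
  let ?V = "\<lambda>F. insert r (\<Union>e\<in>F. {fst e, snd e})"
  define P where "P G \<longleftrightarrow> G \<subseteq> F \<and> card (?V G) \<le> card G + 1" for G
  have "\<exists>G. P G \<and> (\<forall>H. P H \<longrightarrow> card H \<le> card G)"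
    by (rule ex_has_greatest_nat[of P "{}" _ "Suc (card F)"])
      (auto simp: P_def less_Suc_eq_le card_mono[OF assms(1)])
  then obtain G where G: "G \<subseteq> F" "card (?V G) \<le> card G + 1" and max: "\<And>H. P H \<Longrightarrow> card H \<le> card G"
    by (auto simp: P_def)
  have finG: "finite G" using G(1) assms(1) finite_subset by blast
  have no: "fst e \<in> - ?V G \<longleftrightarrow> snd e \<in> - ?V G" if "e \<in> F" for e
  proof (rule ccontr)
    assume cross: "\<not> (fst e \<in> - ?V G \<longleftrightarrow> snd e \<in> - ?V G)"
    then have "e \<notin> G" by auto
    have "\<exists>x. ?V (insert e G) \<subseteq> insert x (?V G)" using cross by auto
    then obtain x where "?V (insert e G) \<subseteq> insert x (?V G)" by blast
    then have "card (?V (insert e G)) \<le> card (insert x (?V G))" using finG by (intro card_mono) auto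
    also have "\<dots> \<le> Suc (card (?V G))" by (rule card_insert_le_m1) auto
    finally have "P (insert e G)" using G that \<open>e \<notin> G\<close> finG by (simp add: P_def)
    from max[OF this] \<open>e \<notin> G\<close> finG show False by simp
  qed
  have "fst e \<notin> - ?V G" if "e \<in> F" for e
    using conn[of "- ?V G" e] no that by auto
  then have "fst e \<in> ?V G \<and> snd e \<in> ?V G" if "e \<in> F" for e using no[OF that] that by blast
  then have "?V F \<subseteq> ?V G" by blast
  then have "card (?V F) \<le> card (?V G)" using finG by (intro card_mono) auto
  also have "\<dots> \<le> card F + 1" using G card_mono[OF assms(1) G(1)] by linarith
  finally show ?thesis .
qed

text \<open>By \<open>cumul_disconnected\<close>, a nonzero cumulant leaves no edges in a cut set
  that avoids the target, so the support is connected to vertex 0. Counting edges with multiplicity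
  only enlarges the right-hand side.\<close>

lemma cumul_nonzero_card_verts:
  assumes E: "finite E" and \<alpha>: "\<alpha> \<in> multi_index E" and nz: "cumul E \<rho> \<alpha> \<noteq> 0"
  shows "card (insert 0 (verts \<alpha>)) \<le> sum \<alpha> E + 1"
proof -
  let ?F = "{e. \<alpha> e > 0}"
  have sub: "?F \<subseteq> E" using \<alpha> by (auto simp: multi_index_def) (metis less_irrefl)
  have "card (insert 0 (\<Union>e\<in>?F. {fst e, snd e})) \<le> card ?F + 1"
  proof (rule card_vertices_connected_le)
    show "finite ?F" using sub E by (rule finite_subset)
    show "fst e \<notin> T" if "0 \<notin> T" "\<And>e. e \<in> ?F \<Longrightarrow> fst e \<in> T \<longleftrightarrow> snd e \<in> T" "e \<in> ?F" for T e
      using cumul_disconnected[OF E that(1) \<alpha>, of \<rho>] that nz by blast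
  qed
  moreover have "card ?F \<le> sum \<alpha> ?F"
    using sum_bounded_below[of ?F 1 \<alpha>] by auto
  moreover have "sum \<alpha> ?F \<le> sum \<alpha> E" by (rule sum_mono2[OF E sub]) auto
  ultimately show ?thesis by (simp add: verts_def)
qed

text \<open>An index of total d + 1 arises from one of total d by raising one coordinate; the bound
  counts ordered choices of edges.\<close>

lemma multi_index_card_le:
  assumes "finite F"
  shows "finite {\<alpha> \<in> multi_index F. sum \<alpha> F = d}
    \<and> card {\<alpha> \<in> multi_index F. sum \<alpha> F = d} \<le> card F ^ d"
proof (induction d)
  case 0
  have "{\<alpha> \<in> multi_index F. sum \<alpha> F = 0} \<subseteq> {\<lambda>_. 0}"
    using assms by (auto simp: multi_index_def fun_eq_iff)
  from finite_subset[OF this] card_mono[OF _ this] show ?case by simp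
next
  case (Suc d)
  let ?A = "\<lambda>d. {\<alpha> \<in> multi_index F. sum \<alpha> F = d}"
  have sub: "?A (Suc d) \<subseteq> (\<Union>e\<in>F. (\<lambda>\<alpha>. \<alpha>(e := Suc (\<alpha> e))) ` ?A d)"
  proof
    fix \<alpha> assume \<alpha>: "\<alpha> \<in> ?A (Suc d)"
    then have "sum \<alpha> F \<noteq> 0" by simp
    then obtain e where e: "e \<in> F" "\<alpha> e > 0" by (meson gr0I sum.neutral)
    define \<beta> where "\<beta> = \<alpha>(e := \<alpha> e - 1)"
    have "sum \<alpha> F = \<alpha> e + sum \<alpha> (F - {e})" "sum \<beta> F = \<beta> e + sum \<beta> (F - {e})"
      using e assms by (simp_all add: sum.remove)
    moreover have "sum \<beta> (F - {e}) = sum \<alpha> (F - {e})" by (intro sum.cong) (auto simp: \<beta>_def)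
    ultimately have "sum \<beta> F = d" using \<alpha> e by (simp add: \<beta>_def)
    moreover have "\<beta> \<in> multi_index F" using \<alpha> e by (auto simp: multi_index_def \<beta>_def)
    moreover have "\<alpha> = \<beta>(e := Suc (\<beta> e))" using e by (auto simp: \<beta>_def)
    ultimately show "\<alpha> \<in> (\<Union>e\<in>F. (\<lambda>\<alpha>. \<alpha>(e := Suc (\<alpha> e))) ` ?A d)" using e by blast
  qed
  have fin: "finite (\<Union>e\<in>F. (\<lambda>\<alpha>. \<alpha>(e := Suc (\<alpha> e))) ` ?A d)" using Suc assms by auto
  have "card (?A (Suc d)) \<le> card (\<Union>e\<in>F. (\<lambda>\<alpha>. \<alpha>(e := Suc (\<alpha> e))) ` ?A d)"
    by (rule card_mono[OF fin sub])
  also have "\<dots> \<le> (\<Sum>e\<in>F. card ((\<lambda>\<alpha>. \<alpha>(e := Suc (\<alpha> e))) ` ?A d))" by (rule card_UN_le[OF assms])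
  also have "\<dots> \<le> (\<Sum>e\<in>F. card F ^ d)"
    using Suc by (intro sum_mono order_trans[OF card_image_le]) auto
  finally show ?case using finite_subset[OF sub fin] by simp
qed

lemma sum_multi_index_cong:
  assumes "finite E" "finite F" "\<alpha> \<in> multi_index E" "\<alpha> \<in> multi_index F"
  shows "sum \<alpha> E = sum \<alpha> F"
proof -
  have "sum \<alpha> E = sum \<alpha> (E \<inter> F)" "sum \<alpha> F = sum \<alpha> (E \<inter> F)"
    using assms(1,2) multi_indexD[OF assms(3)] multi_indexD[OF assms(4)]
    by (intro sum.mono_neutral_right; blast)+
  then show ?thesis by simp
qed

text \<open>Choose the \<open>h\<close> vertices other than the target in at most
  \<open>n ^ h\<close> ways, then \<open>d\<close> edges among the \<open>(h + 1)^2\<close> ordered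
  pairs of the chosen vertices and the target.\<close>

lemma multi_index_card_verts:
  assumes E: "E \<subseteq> {0..<n} \<times> {0..<n}"
  shows "card {\<alpha> \<in> multi_index E. sum \<alpha> E = d \<and> card (insert 0 (verts \<alpha>)) = Suc h}
    \<le> n ^ h * ((h + 1)\<^sup>2) ^ d"
proof -
  let ?B = "{\<alpha> \<in> multi_index E. sum \<alpha> E = d \<and> card (insert 0 (verts \<alpha>)) = Suc h}"
  define C where "C S = {\<alpha> \<in> multi_index (insert 0 S \<times> insert 0 S). sum \<alpha> (insert 0 S \<times> insert 0 S) = d}"
    for S :: "nat set"
  let ?Q = "{S. S \<subseteq> {1..<n} \<and> card S = h}"
  have finE: "finite E" using E finite_subset by blast
  have finQ: "finite ?Q" by simp
  have finS: "finite S" if "S \<in> ?Q" for S using that finite_subset by auto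
  have sub: "?B \<subseteq> (\<Union>S\<in>?Q. C S)"
  proof
    fix \<alpha> assume \<alpha>: "\<alpha> \<in> ?B"
    then have \<alpha>E: "\<alpha> \<in> multi_index E" by blast
    have supp: "e \<in> E" if "\<alpha> e > 0" for e
      using that \<alpha>E unfolding multi_index_def by (metis (mono_tags) less_irrefl mem_Collect_eq)
    let ?S = "verts \<alpha> - {0}"
    let ?SS = "insert 0 ?S \<times> insert 0 ?S"
    have finV: "finite (verts \<alpha>)" by (rule finite_verts[OF finE \<alpha>E])
    have "fst e < n \<and> snd e < n" if "\<alpha> e > 0" for e
      using supp[OF that] E by (cases e) auto
    then have "verts \<alpha> \<subseteq> {0..<n}" unfolding verts_def by auto
    moreover have "card ?S = h" using \<alpha> finV by (simp add: card_insert_if split: if_splits)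
    ultimately have "?S \<in> ?Q" by auto
    moreover have m: "\<alpha> \<in> multi_index ?SS"
    proof -
      have "e \<in> ?SS" if "\<alpha> e > 0" for e
      proof -
        have "fst e \<in> verts \<alpha>" "snd e \<in> verts \<alpha>" using that unfolding verts_def by blast+
        then show ?thesis by (cases e) auto
      qed
      then show ?thesis unfolding multi_index_def by blast
    qed
    moreover have "sum \<alpha> ?SS = sum \<alpha> E"
      by (rule sum_multi_index_cong[OF _ finE m \<alpha>E]) (use finV in simp)
    moreover have "sum \<alpha> E = d" using \<alpha> by blast
    ultimately have "?S \<in> ?Q" "\<alpha> \<in> C ?S" unfolding C_def by simp_all
    then show "\<alpha> \<in> (\<Union>S\<in>?Q. C S)" by (rule UN_I)
  qed
  have C: "finite (C S) \<and> card (C S) \<le> ((h + 1)\<^sup>2) ^ d" if "S \<in> ?Q" for S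
  proof -
    have "0 \<notin> S" "card S = h" using that by auto
    then have "card (insert 0 S) = h + 1" using finS[OF that] by simp
    then have card: "card (insert 0 S \<times> insert 0 S) = (h + 1)\<^sup>2"
      by (simp only: card_cartesian_product power2_eq_square)
    have "finite (insert 0 S \<times> insert 0 S)" using finS[OF that] by blast
    from multi_index_card_le[OF this, of d] show ?thesis unfolding C_def card .
  qed
  have "card ?B \<le> card (\<Union>S\<in>?Q. C S)" by (rule card_mono[OF finite_UN_I[OF finQ] sub]) (use C in blast)
  also have "\<dots> \<le> (\<Sum>S\<in>?Q. card (C S))" by (rule card_UN_le[OF finQ])
  also have "\<dots> \<le> (\<Sum>S\<in>?Q. ((h + 1)\<^sup>2) ^ d)" using C by (intro sum_mono) blast
  also have "\<dots> = ((n - 1) choose h) * ((h + 1)\<^sup>2) ^ d" by (simp add: n_subsets)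
  also have "\<dots> \<le> n ^ h * ((h + 1)\<^sup>2) ^ d"
  proof (rule mult_right_mono)
    show "((n - 1) choose h) \<le> n ^ h"
    proof (cases "h \<le> n - 1")
      case True
      then have "((n - 1) choose h) \<le> (n - 1) ^ h" by (rule binomial_le_pow)
      also have "\<dots> \<le> n ^ h" by (rule power_mono) auto
      finally show ?thesis .
    qed (simp add: binomial_eq_0)
  qed simp
  finally show ?thesis .
qed

section \<open>Summing the squared cumulants\<close>

text \<open>A partial sum of the differentiated geometric series. Its closed form shows that the
  deviation from the limit has the right sign.\<close>

lemma sum_Suc_power_le:
  fixes q :: real
  assumes "0 \<le> q" "q < 1"
  shows "(\<Sum>d\<le>D. real (Suc d) * q ^ d) \<le> 1 / (1 - q)\<^sup>2"
proof -
  have "(1 - q)\<^sup>2 * (\<Sum>d\<le>D. real (Suc d) * q ^ d) =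
      1 - real (D + 2) * q ^ (D + 1) + real (D + 1) * q ^ (D + 2)"
  proof (induction D)
    case 0
    show ?case by (simp add: power2_eq_square algebra_simps)
  next
    case (Suc D)
    have "(1 - q)\<^sup>2 * (\<Sum>d\<le>Suc D. real (Suc d) * q ^ d) = 
        (1 - q)\<^sup>2 * (\<Sum>d\<le>D. real (Suc d) * q ^ d) + (1 - q)\<^sup>2 * ((real D + 2) * (q * q ^ D))"
      by (simp add: distrib_left)
    also have "\<dots> = 1 - (real D + 2) * (q * q ^ D) + (real D + 1) * (q * (q * q ^ D)) + (1 - q)\<^sup>2 * ((real D + 2) * (q * q ^ D))"
      by (simp only: Suc) (simp add: add.commute)
    also have "\<dots> = 1 - (real D + 3) * (q * (q * q ^ D)) + (real D + 2) * (q * (q * (q * q ^ D)))"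
      by algebra
    finally show ?case by (simp add: add.commute)
  qed
  also have "\<dots> \<le> 1"
  proof -
    have "real (D + 1) * q ^ (D + 2) \<le> real (D + 2) * q ^ (D + 1)"
      using assms by (intro mult_mono power_decreasing) auto
    then show ?thesis by simp
  qed
  finally show ?thesis using assms by (simp add: field_simps)
qed

text \<open>The number \<open>h\<close> of vertices besides the target runs from 0 to
  \<open>d\<close>, and each value contributes at most \<rho>^2 r^(2d). This is the origin of the
  factor \<open>Suc d\<close>, and hence of the square in the final denominator.\<close>

lemma sum_cumul_square_level:
  fixes \<rho> lam r :: real
  assumes E: "E \<subseteq> {0..<n} \<times> {0..<n}" and n: "n \<ge> 1" and rho: "0 < \<rho>" "\<rho> < 1"
    and r: "0 < r" and lam: "0 \<le> lam"
    and le: "lam * real d * (real d + 1) \<le> r * min 1 (1 / (\<rho> * sqrt (real n)))"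
  shows "(\<Sum>\<alpha> | \<alpha> \<in> multi_index E \<and> sum \<alpha> E = d. (lam ^ d * cumul E \<rho> \<alpha>)\<^sup>2) \<le> real (Suc d) * (\<rho>\<^sup>2 * (r\<^sup>2) ^ d)"
proof -
  have finE: "finite E" using E finite_subset by blast
  define mu where "mu = min 1 (1 / (\<rho> * sqrt (real n)))"
  have mu: "0 < mu" "mu \<le> 1" "\<rho> * sqrt (real n) * mu \<le> 1"
    using rho n by (auto simp: mu_def min_def field_simps)
  define B where "B h = {\<alpha> \<in> multi_index E. sum \<alpha> E = d \<and> card (insert 0 (verts \<alpha>)) = Suc h}" for h
  let ?A = "{\<alpha>. \<alpha> \<in> multi_index E \<and> sum \<alpha> E = d}"
  have finA: "finite ?A" using multi_index_card_le[OF finE] by simp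
  have BA: "B h \<subseteq> ?A" for h by (auto simp: B_def)
  have finB: "finite (B h)" for h using BA finA finite_subset by blast
  define G where "G \<alpha> = (lam ^ d * cumul E \<rho> \<alpha>)\<^sup>2" for \<alpha>
  have level: "(\<Sum>\<alpha>\<in>B h. G \<alpha>) \<le> \<rho>\<^sup>2 * (r\<^sup>2) ^ d" if h: "h \<le> d" for h
  proof -
    have G: "G \<alpha> \<le> (lam ^ d * real d ^ d * \<rho> ^ Suc h)\<^sup>2" if "\<alpha> \<in> B h" for \<alpha>
    proof -
      have "\<bar>cumul E \<rho> \<alpha>\<bar> \<le> real d ^ d * \<rho> ^ Suc h"
        using cumul_bound[OF finE _ rho, of \<alpha>] that by (auto simp: B_def)
      then have "\<bar>lam ^ d * cumul E \<rho> \<alpha>\<bar> \<le> lam ^ d * (real d ^ d * \<rho> ^ Suc h)"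
        using lam by (simp add: abs_mult mult_left_mono)
      then show ?thesis unfolding G_def by (intro abs_le_square_iff[THEN iffD1]) (simp add: mult.assoc)
    qed
    have "(\<Sum>\<alpha>\<in>B h. G \<alpha>) \<le> real (card (B h)) * (lam ^ d * real d ^ d * \<rho> ^ Suc h)\<^sup>2"
      using sum_bounded_above[of "B h" G, OF G] by simp
    also have "\<dots> \<le> real (n ^ h * ((h + 1)\<^sup>2) ^ d) * (lam ^ d * real d ^ d * \<rho> ^ Suc h)\<^sup>2"
      using multi_index_card_verts[OF E, of d h] unfolding B_def
      by (intro mult_right_mono) (simp_all only: of_nat_le_iff zero_le_power2)
    also have "\<dots> \<le> real n ^ h * ((real d + 1)\<^sup>2) ^ d * (lam ^ d * real d ^ d * \<rho> ^ Suc h)\<^sup>2"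
      using h by (intro mult_right_mono) (simp_all add: mult_left_mono power_mono)
    \<comment> \<open>The vertex count \<open>n ^ h\<close> is paired with the \<rho>^(2h) of the
      squared cumulant bound, and the cumulant factor \<open>d ^ d\<close> with the number of edge
      placements.\<close>
    also have "\<dots> = \<rho>\<^sup>2 * (\<rho> * sqrt (real n)) ^ (2 * h) * (lam * real d * (real d + 1)) ^ (2 * d)"
    proof -
      have "(\<rho> * sqrt (real n)) ^ (2 * h) = (\<rho>\<^sup>2) ^ h * real n ^ h"
        by (simp add: power_mult power_mult_distrib)
      moreover have "(lam * real d * (real d + 1)) ^ (2 * d) = (lam ^ d * real d ^ d)\<^sup>2 * ((real d + 1)\<^sup>2) ^ d"
        by (simp only: power_even_eq power_mult_distrib flip: power_mult)

      moreover have "(lam ^ d * real d ^ d * \<rho> ^ Suc h)\<^sup>2 = (lam ^ d * real d ^ d)\<^sup>2 * (\<rho>\<^sup>2 * (\<rho>\<^sup>2) ^ h)"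
        by (simp add: power_mult_distrib power2_eq_square)
      ultimately show ?thesis by (simp only: mult_ac)
    qed
    also have "\<dots> \<le> \<rho>\<^sup>2 * (\<rho> * sqrt (real n)) ^ (2 * h) * (r * mu) ^ (2 * d)"
      using le lam rho by (intro mult_left_mono power_mono) (auto simp: mu_def)
    \<comment> \<open>Since \<open>mu \<le> 1\<close> and \<open>h \<le> d\<close>, the power of
      \<open>mu\<close> may be lowered to \<open>2 * h\<close>, which is what the factor in \<rho>
      sqrt n has to be paired with.\<close>
    also have "\<dots> \<le> \<rho>\<^sup>2 * (\<rho> * sqrt (real n)) ^ (2 * h) * (r ^ (2 * d) * mu ^ (2 * h))"
      unfolding power_mult_distrib[of r mu] using mu rho h r
      by (intro mult_left_mono power_decreasing) auto
    also have "\<dots> = \<rho>\<^sup>2 * r ^ (2 * d) * (\<rho> * sqrt (real n) * mu) ^ (2 * h)"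
      by (simp add: power_mult_distrib)
    also have "\<dots> \<le> \<rho>\<^sup>2 * r ^ (2 * d) * 1"
      using mu rho r by (intro mult_left_mono power_le_one) auto
    finally show ?thesis by (simp add: power_mult)
  qed
  \<comment> \<open>The levels \<open>B h\<close> with \<open>h \<le> d\<close> suffice: more than d
    + 1 vertices, the target included, force a zero cumulant.\<close>
  have "(\<Sum>\<alpha>\<in>?A. G \<alpha>) = (\<Sum>\<alpha>\<in>(\<Union>h\<in>{..d}. B h). G \<alpha>)"
  proof (rule sum.mono_neutral_right[OF finA])
    show "\<forall>\<alpha>\<in>?A - (\<Union>h\<in>{..d}. B h). G \<alpha> = 0"
    proof
      fix \<alpha> assume a: "\<alpha> \<in> ?A - (\<Union>h\<in>{..d}. B h)"
      show "G \<alpha> = 0"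
      proof (rule ccontr)
        assume "G \<alpha> \<noteq> 0"
        then have nz: "cumul E \<rho> \<alpha> \<noteq> 0" by (auto simp: G_def)
        have m: "\<alpha> \<in> multi_index E" "sum \<alpha> E = d" using a by blast+
        have "card (insert 0 (verts \<alpha>)) \<le> d + 1"
          using cumul_nonzero_card_verts[OF finE m(1) nz] m(2) by simp
        moreover have "card (insert 0 (verts \<alpha>)) \<noteq> 0" using finite_verts[OF finE m(1)] by simp
        ultimately obtain h where "card (insert 0 (verts \<alpha>)) = Suc h" "h \<le> d"
          by (metis Suc_eq_plus1 Suc_le_mono not0_implies_Suc)
        then have "\<alpha> \<in> B h" "h \<le> d" using m unfolding B_def by blast+
        then show False using a by blast
      qed
    qed
  qed (use BA in blast)
  also have "\<dots> = (\<Sum>h\<le>d. \<Sum>\<alpha>\<in>B h. G \<alpha>)"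
    by (rule sum.UNION_disjoint) (use finB in \<open>auto simp: B_def\<close>)
  also have "\<dots> \<le> (\<Sum>h\<le>d. \<rho>\<^sup>2 * (r\<^sup>2) ^ d)" using level by (intro sum_mono) auto
  finally show ?thesis by (simp add: G_def)
qed

lemma sum_cumul_square_le:
  fixes \<rho> lam r :: real
  assumes E: "E \<subseteq> {0..<n} \<times> {0..<n}" and n: "n \<ge> 1" and rho: "0 < \<rho>" "\<rho> < 1"
    and r: "0 < r" "r < 1" and lam: "0 \<le> lam" and D: "D \<ge> 1"
    and le: "lam \<le> r / (real D * (real D + 1)) * min 1 (1 / (\<rho> * sqrt (real n)))"
  shows "(\<Sum>\<alpha> | \<alpha> \<in> multi_index E \<and> sum \<alpha> E \<le> D. (lam ^ sum \<alpha> E * cumul E \<rho> \<alpha>)\<^sup>2) \<le> \<rho>\<^sup>2 / (1 - r\<^sup>2)\<^sup>2"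
proof -
  have finE: "finite E" using E finite_subset by blast
  let ?A = "\<lambda>d. {\<alpha>. \<alpha> \<in> multi_index E \<and> sum \<alpha> E = d}"
  have finA: "finite (?A d)" for d using multi_index_card_le[OF finE] by simp
  have U: "{\<alpha>. \<alpha> \<in> multi_index E \<and> sum \<alpha> E \<le> D} = (\<Union>d\<in>{..D}. ?A d)" by auto
  have "(\<Sum>\<alpha> | \<alpha> \<in> multi_index E \<and> sum \<alpha> E \<le> D. (lam ^ sum \<alpha> E * cumul E \<rho> \<alpha>)\<^sup>2) =
     (\<Sum>d\<le>D. \<Sum>\<alpha>\<in>?A d. (lam ^ sum \<alpha> E * cumul E \<rho> \<alpha>)\<^sup>2)"
    unfolding U by (rule sum.UNION_disjoint) (use finA in auto)
  also have "\<dots> = (\<Sum>d\<le>D. \<Sum>\<alpha>\<in>?A d. (lam ^ d * cumul E \<rho> \<alpha>)\<^sup>2)"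
    by (intro sum.cong) auto
  also have "\<dots> \<le> (\<Sum>d\<le>D. real (Suc d) * (\<rho>\<^sup>2 * (r\<^sup>2) ^ d))"
  proof (intro sum_mono sum_cumul_square_level[OF E n rho r(1) lam])
    \<comment> \<open>The condition at degree \<open>D\<close> passes to every smaller degree
      because d(d+1) is increasing.\<close>
    fix d assume "d \<in> {..D}"
    then have "lam * (real d * (real d + 1)) \<le> lam * (real D * (real D + 1))"
      using lam by (intro mult_left_mono mult_mono) auto
    also have "\<dots> \<le> r * min 1 (1 / (\<rho> * sqrt (real n)))"
    proof -
      have "lam * (real D * (real D + 1)) \<le> r / (real D * (real D + 1)) * min 1 (1 / (\<rho> * sqrt (real n))) * (real D * (real D + 1))"
        using le by (rule mult_right_mono) simp
      also have "\<dots> = r * min 1 (1 / (\<rho> * sqrt (real n)))" using D by simp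
      finally show ?thesis .
    qed
    finally show "lam * real d * (real d + 1) \<le> r * min 1 (1 / (\<rho> * sqrt (real n)))" by (simp add: mult.assoc)
  qed
  also have "\<dots> = \<rho>\<^sup>2 * (\<Sum>d\<le>D. real (Suc d) * (r\<^sup>2) ^ d)"
    by (simp add: sum_distrib_left algebra_simps)
  also have "\<dots> \<le> \<rho>\<^sup>2 * (1 / (1 - r\<^sup>2)\<^sup>2)"
    using r by (intro mult_left_mono sum_Suc_power_le) (auto simp: power_less_one_iff abs_square_less_1)
  finally show ?thesis by simp
qed

section \<open>Hermite polynomials\<close>

text \<open>The probabilists' Hermite polynomials. The recursion is multiplication by x minus
  differentiation, which is the adjoint of differentiation under the standard normal law.\<close>

primrec hermite :: "nat \<Rightarrow> real poly" where
  "hermite 0 = 1"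
| "hermite (Suc n) = [:0, 1:] * hermite n - pderiv (hermite n)"

lemma pderiv_hermite_Suc: "pderiv (hermite (Suc n)) = smult (real (Suc n)) (hermite n)"
proof (induction n)
  case 0
  show ?case by (simp add: pderiv_pCons)
next
  case (Suc n)
  have "pderiv (hermite (Suc (Suc n))) =
      hermite (Suc n) + [:0, 1:] * pderiv (hermite (Suc n)) - pderiv (pderiv (hermite (Suc n)))"
    by (simp add: pderiv_diff pderiv_mult pderiv_pCons)
  also have "\<dots> = hermite (Suc n) + smult (real (Suc n)) ([:0, 1:] * hermite n - pderiv (hermite n))"
    by (simp only: Suc pderiv_smult smult_diff_right mult_smult_right)
  also have "\<dots> = smult (real (Suc (Suc n))) (hermite (Suc n))"
    by (simp only: hermite.simps(2)[symmetric] of_nat_Suc[of "Suc n"] smult_add_left smult_1_left)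
  finally show ?case .
qed

lemma pderiv_hermite: "pderiv (hermite n) = smult (real n) (hermite (n - 1))"
  by (cases n) (simp_all del: hermite.simps(2) add: pderiv_hermite_Suc)

lemma poly_hermite_Suc:
  "poly (hermite (Suc n)) x = x * poly (hermite n) x - real n * poly (hermite (n - 1)) x"
  by (simp add: pderiv_hermite)

text \<open>Pascal's rule for an arbitrary sequence in place of powers; with Hermite values it
  closes the induction in the shift formula.\<close>

lemma pascal_sum:
  fixes h :: "nat \<Rightarrow> real"
  shows "(\<Sum>k\<le>Suc n. real (Suc n choose k) * y ^ (Suc n - k) * h k) =
    (\<Sum>k\<le>n. real (n choose k) * y ^ (n - k) * (h (Suc k) + y * h k))"
proof -
  have "(\<Sum>k\<le>Suc n. real (Suc n choose k) * y ^ (Suc n - k) * h k) =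
      y ^ Suc n * h 0 + (\<Sum>k\<le>n. real (Suc n choose Suc k) * y ^ (n - k) * h (Suc k))"
    by (subst sum.atMost_Suc_shift) simp
  also have "(\<Sum>k\<le>n. real (Suc n choose Suc k) * y ^ (n - k) * h (Suc k)) =
      (\<Sum>k\<le>n. real (n choose k) * y ^ (n - k) * h (Suc k)) +
      (\<Sum>k\<le>n. real (n choose Suc k) * y ^ (n - k) * h (Suc k))"
    by (simp add: algebra_simps sum.distrib)
  also have "y ^ Suc n * h 0 + ((\<Sum>k\<le>n. real (n choose k) * y ^ (n - k) * h (Suc k)) +
      (\<Sum>k\<le>n. real (n choose Suc k) * y ^ (n - k) * h (Suc k))) =
      (\<Sum>k\<le>n. real (n choose k) * y ^ (n - k) * h (Suc k)) +
      (y ^ Suc n * h 0 + (\<Sum>k\<le>n. real (n choose Suc k) * y ^ (Suc n - Suc k) * h (Suc k)))"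
    by simp
  also have "y ^ Suc n * h 0 + (\<Sum>k\<le>n. real (n choose Suc k) * y ^ (Suc n - Suc k) * h (Suc k)) =
      (\<Sum>k\<le>Suc n. real (n choose k) * y ^ (Suc n - k) * h k)"
    by (subst sum.atMost_Suc_shift) simp
  also have "\<dots> = (\<Sum>k\<le>n. real (n choose k) * y ^ (n - k) * (y * h k))"
    by (simp add: Suc_diff_le mult_ac)
  finally show ?thesis by (simp only: distrib_left sum.distrib)
qed

text \<open>The binomial theorem with Hermite polynomials as powers of the first summand. It is
  applied with \<open>x\<close> the noise and \<open>y\<close> the signal. Both terms of the
  three-term recurrence are expanded by induction and recombined by Pascal's rule.\<close>

lemma hermite_shift:
  "poly (hermite n) (x + y) = (\<Sum>k\<le>n. real (n choose k) * y ^ (n - k) * poly (hermite k) x)"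
proof (induction n rule: less_induct)
  case (less n)
  show ?case
  proof (cases n)
    case 0
    then show ?thesis by simp
  next
    case (Suc m)
    let ?H = "\<lambda>k x. poly (hermite k) x"
    have IH: "?H m (x + y) = (\<Sum>k\<le>m. real (m choose k) * y ^ (m - k) * ?H k x)"
      using less Suc by simp
    \<comment> \<open>The absorption identity k C(m,k) = m C(m-1,k-1) brings the lower-order term to
      the same summation range.\<close>
    have lower: "real m * ?H (m - 1) (x + y) =
        (\<Sum>k\<le>m. real (m choose k) * y ^ (m - k) * (real k * ?H (k - 1) x))"
    proof (cases m)
      case (Suc l)
      have "(\<Sum>k\<le>m. real (m choose k) * y ^ (m - k) * (real k * ?H (k - 1) x)) =
          (\<Sum>k\<le>l. real (m choose Suc k) * y ^ (l - k) * (real (Suc k) * ?H k x))"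
        unfolding Suc by (subst sum.atMost_Suc_shift) simp
      also have "\<dots> = (\<Sum>k\<le>l. real m * (real (l choose k) * y ^ (l - k) * ?H k x))"
      proof (rule sum.cong[OF refl])
        fix k
        have "real (Suc k) * real (Suc l choose Suc k) = real (Suc l) * real (l choose k)"
          unfolding of_nat_mult[symmetric] by (simp only: Suc_times_binomial)
        then show "real (m choose Suc k) * y ^ (l - k) * (real (Suc k) * ?H k x) =
            real m * (real (l choose k) * y ^ (l - k) * ?H k x)"
          unfolding Suc by (metis (no_types, opaque_lifting) mult.assoc mult.commute)
      qed
      also have "\<dots> = real m * ?H l (x + y)"
        using less[of l] \<open>n = Suc m\<close> Suc by (simp add: sum_distrib_left)
      finally show ?thesis by (simp add: Suc)
    qed simp
    have "?H (Suc m) (x + y) = (x + y) * ?H m (x + y) - real m * ?H (m - 1) (x + y)"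
      by (rule poly_hermite_Suc)
    also have "\<dots> = (\<Sum>k\<le>m. real (m choose k) * y ^ (m - k) * (?H (Suc k) x + y * ?H k x))"
      unfolding lower IH poly_hermite_Suc sum_distrib_left sum_subtractf[symmetric]
      by (intro sum.cong) (simp_all add: algebra_simps)
    also have "\<dots> = (\<Sum>k\<le>Suc m. real (Suc m choose k) * y ^ (Suc m - k) * ?H k x)"
      by (rule pascal_sum[symmetric])
    finally show ?thesis unfolding Suc .
  qed
qed

section \<open>Gaussian expectations of polynomials\<close>

abbreviation gaussian :: "real \<Rightarrow> real measure" where
  "gaussian \<sigma> \<equiv> density lborel (normal_density 0 \<sigma>)"

text \<open>Dividing by the standard deviation lets diagonal and off-diagonal noise share the same
  Hermite polynomials.\<close>

definition gauss_mean :: "real \<Rightarrow> real poly \<Rightarrow> real" where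
  "gauss_mean \<sigma> p = (\<integral>z. poly p (z / \<sigma>) \<partial>gaussian \<sigma>)"

lemma integrable_gaussian_monom:
  assumes "0 < \<sigma>"
  shows "integrable (gaussian \<sigma>) (\<lambda>z. (z / \<sigma>) ^ k)"
proof -
  have "integrable lborel (\<lambda>z. normal_density 0 \<sigma> z * (z - 0) ^ k)"
    by (rule integrable_normal_moment[OF assms])
  then have "integrable lborel (\<lambda>z. normal_density 0 \<sigma> z * (z - 0) ^ k / \<sigma> ^ k)"
    by (rule integrable_divide_zero)
  then show ?thesis
    by (simp add: integrable_density normal_density_nonneg power_divide)
qed

lemma integrable_gaussian_poly:
  assumes "0 < \<sigma>"
  shows "integrable (gaussian \<sigma>) (\<lambda>z. poly p (z / \<sigma>))"
  unfolding poly_altdef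
  by (intro Bochner_Integration.integrable_sum integrable_mult_right integrable_gaussian_monom assms)

lemma gauss_mean_moment:
  assumes "0 < \<sigma>"
  shows "gauss_mean \<sigma> (monom 1 (2 * k)) = fact (2 * k) / (2 ^ k * fact k)"
    and "gauss_mean \<sigma> (monom 1 (2 * k + 1)) = 0"
proof -
  have eq: "gauss_mean \<sigma> (monom 1 i) = (\<integral>z. normal_density 0 \<sigma> z * (z - 0) ^ i \<partial>lborel) / \<sigma> ^ i" for i
    unfolding gauss_mean_def
    by (subst integral_density) (simp_all add: normal_density_nonneg poly_monom power_divide)
  show "gauss_mean \<sigma> (monom 1 (2 * k)) = fact (2 * k) / (2 ^ k * fact k)"
    unfolding eq has_bochner_integral_integral_eq[OF normal_moment_even[OF assms]]
    using assms by (simp add: power_divide power_mult)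
  show "gauss_mean \<sigma> (monom 1 (2 * k + 1)) = 0"
    unfolding eq has_bochner_integral_integral_eq[OF normal_moment_odd[OF assms]] by simp
qed

lemma gauss_mean_add:
  "0 < \<sigma> \<Longrightarrow> gauss_mean \<sigma> (p + q) = gauss_mean \<sigma> p + gauss_mean \<sigma> q"
  by (simp add: gauss_mean_def integrable_gaussian_poly)

lemma gauss_mean_diff:
  "0 < \<sigma> \<Longrightarrow> gauss_mean \<sigma> (p - q) = gauss_mean \<sigma> p - gauss_mean \<sigma> q"
  by (simp add: gauss_mean_def integrable_gaussian_poly)

lemma gauss_mean_smult: "gauss_mean \<sigma> (smult c p) = c * gauss_mean \<sigma> p"
  by (simp add: gauss_mean_def)

lemma gauss_mean_sum:
  "0 < \<sigma> \<Longrightarrow> gauss_mean \<sigma> (\<Sum>i\<in>A. f i) = (\<Sum>i\<in>A. gauss_mean \<sigma> (f i))"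
  by (simp add: gauss_mean_def integrable_gaussian_poly poly_sum)

lemma gauss_mean_stein_monom:
  assumes "0 < \<sigma>"
  shows "gauss_mean \<sigma> (monom 1 (Suc i)) = real i * gauss_mean \<sigma> (monom 1 (i - 1))"
proof (cases "even i")
  case True
  then obtain k where k: "i = 2 * k" by (auto elim: evenE)
  show ?thesis
  proof (cases k)
    case (Suc l)
    then have "Suc i = 2 * k + 1" "i - 1 = 2 * l + 1" using k by auto
    then show ?thesis
      using gauss_mean_moment(2)[OF assms, of k] gauss_mean_moment(2)[OF assms, of l] by simp
  qed (use k gauss_mean_moment(2)[OF assms, of 0] in simp)
next
  case False
  then obtain k where k: "i = 2 * k + 1" by (auto elim: oddE)
  then have "Suc i = 2 * Suc k" "i - 1 = 2 * k" by auto
  then have "gauss_mean \<sigma> (monom 1 (Suc i)) = fact (2 * Suc k) / (2 ^ Suc k * fact (Suc k))"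
    "gauss_mean \<sigma> (monom 1 (i - 1)) = fact (2 * k) / (2 ^ k * fact k)"
    using gauss_mean_moment(1)[OF assms] by metis+
  moreover have "fact (2 * Suc k) / (2 ^ Suc k * fact (Suc k)) = real i * (fact (2 * k) / (2 ^ k * fact k))"
  proof -
    have "fact (2 * Suc k) = (2 * (real k + 1)) * ((2 * real k + 1) * fact (2 * k))"
      by (simp add: algebra_simps)
    moreover have "2 ^ Suc k * fact (Suc k) = (2 * (real k + 1)) * (2 ^ k * fact k)"
      by (simp add: algebra_simps)
    ultimately have "fact (2 * Suc k) / (2 ^ Suc k * fact (Suc k)) = ((2 * real k + 1) * fact (2 * k)) / (2 ^ k * fact k)"
      by (simp only:) (rule mult_divide_mult_cancel_left, simp)
    then show ?thesis by (simp add: k)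
  qed
  ultimately show ?thesis by simp
qed

lemma pderiv_sum: "pderiv (\<Sum>i\<in>A. f i) = (\<Sum>i\<in>A. pderiv (f i))"
  by (induction A rule: infinite_finite_induct) (simp_all add: pderiv_add)

text \<open>Gaussian integration by parts. On monomials it is a relation between explicit moments;
  linearity does the rest.\<close>

lemma gauss_mean_stein:
  assumes "0 < \<sigma>"
  shows "gauss_mean \<sigma> ([:0, 1:] * p) = gauss_mean \<sigma> (pderiv p)"
proof -
  have monom: "gauss_mean \<sigma> ([:0, 1:] * monom c i) = gauss_mean \<sigma> (pderiv (monom c i))" for c i
  proof -
    have "[:0, 1:] * monom c i = smult c (monom 1 (Suc i))"
      by (simp add: monom_Suc smult_monom)
    moreover have "pderiv (monom c i) = smult (c * real i) (monom 1 (i - 1))"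
      by (simp add: pderiv_monom smult_monom mult.commute)
    ultimately show ?thesis by (simp add: gauss_mean_smult gauss_mean_stein_monom[OF assms])
  qed
  have "gauss_mean \<sigma> ([:0, 1:] * (\<Sum>i\<le>degree p. monom (coeff p i) i)) =
      gauss_mean \<sigma> (pderiv (\<Sum>i\<le>degree p. monom (coeff p i) i))"
    unfolding sum_distrib_left pderiv_sum gauss_mean_sum[OF assms] by (intro sum.cong refl monom)
  then show ?thesis by (simp only: poly_as_sum_of_monoms)
qed

text \<open>Raising the index is adjoint to differentiation: Stein's identity produces both terms of
  the product rule, and the recursion cancels one of them.\<close>

lemma gauss_mean_hermite_mult:
  assumes "0 < \<sigma>"
  shows "gauss_mean \<sigma> (hermite (Suc m) * q) = gauss_mean \<sigma> (hermite m * pderiv q)"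
proof -
  have "gauss_mean \<sigma> (hermite (Suc m) * q) =
      gauss_mean \<sigma> ([:0, 1:] * (hermite m * q)) - gauss_mean \<sigma> (pderiv (hermite m) * q)"
    unfolding gauss_mean_diff[OF assms, symmetric]
    by (simp only: hermite.simps left_diff_distrib mult.assoc)
  also have "gauss_mean \<sigma> ([:0, 1:] * (hermite m * q)) =
      gauss_mean \<sigma> (hermite m * pderiv q) + gauss_mean \<sigma> (pderiv (hermite m) * q)"
    unfolding gauss_mean_stein[OF assms] pderiv_mult gauss_mean_add[OF assms] by (simp add: mult.commute)
  finally show ?thesis by simp
qed

text \<open>Adjointness lowers both indices by one and produces the factor k, so the mean ends at
  the factorial or at the derivative of a constant. In the step for \<open>k = 0\<close> that factor
  makes the truncated \<open>k - 1\<close> harmless.\<close>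

lemma hermite_orthogonal:
  assumes "0 < \<sigma>"
  shows "gauss_mean \<sigma> (hermite m * hermite k) = (if m = k then fact m else 0)"
proof (induction m arbitrary: k)
  case 0
  have one: "gauss_mean \<sigma> (hermite 0 * hermite 0) = 1"
    using gauss_mean_moment(1)[OF assms, of 0] by (simp add: monom_0 one_pCons)
  have "gauss_mean \<sigma> (hermite 0 * hermite (Suc l)) = 0" for l
    using gauss_mean_hermite_mult[OF assms, of l 1] gauss_mean_smult[of \<sigma> 0 0]
    by (simp add: pderiv_1)
  then show ?case using one by (cases k) (auto simp del: hermite.simps)
next
  case (Suc m)
  have "gauss_mean \<sigma> (hermite (Suc m) * hermite k) = real k * gauss_mean \<sigma> (hermite m * hermite (k - 1))"
    unfolding gauss_mean_hermite_mult[OF assms] pderiv_hermite mult_smult_right gauss_mean_smult ..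
  then show ?case using Suc[of "k - 1"] by (cases k) auto
qed

section \<open>The dual certificate\<close>

text \<open>The linear span, generated inductively so that closure properties and linear identities
  follow by rule induction.\<close>

inductive_set fspan :: "('a \<Rightarrow> real) set \<Rightarrow> ('a \<Rightarrow> real) set" for B where
  base: "f \<in> B \<Longrightarrow> f \<in> fspan B"
| zero: "(\<lambda>_. 0) \<in> fspan B"
| add: "f \<in> fspan B \<Longrightarrow> g \<in> fspan B \<Longrightarrow> (\<lambda>x. f x + g x) \<in> fspan B"
| scale: "f \<in> fspan B \<Longrightarrow> (\<lambda>x. c * f x) \<in> fspan B"

lemma fspan_sum: "(\<And>i. i \<in> A \<Longrightarrow> f i \<in> fspan B) \<Longrightarrow> (\<lambda>x. \<Sum>i\<in>A. f i x) \<in> fspan B"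
  by (induction A rule: infinite_finite_induct) (auto intro: fspan.zero fspan.add)

lemma fspan_diff: "f \<in> fspan B \<Longrightarrow> g \<in> fspan B \<Longrightarrow> (\<lambda>x. f x - g x) \<in> fspan B"
  using fspan.add[OF _ fspan.scale[of g B "-1"]] by simp

lemma fspan_mono:
  assumes "B \<subseteq> C" "f \<in> fspan B" shows "f \<in> fspan C"
  using assms(2) by induction (use assms(1) in \<open>auto intro: fspan.intros\<close>)

section \<open>Moments under the planted law\<close>

lemma has_bochner_integral_pair_mult:
  fixes f :: "'a \<Rightarrow> real" and g :: "'b \<Rightarrow> real"
  assumes "prob_space A" "prob_space B"
    and f: "has_bochner_integral A f a" and g: "has_bochner_integral B g b"
  shows "has_bochner_integral (A \<Otimes>\<^sub>M B) (\<lambda>\<omega>. f (fst \<omega>) * g (snd \<omega>)) (a * b)"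
proof -
  interpret A: prob_space A by fact
  interpret B: prob_space B by fact
  interpret pair_sigma_finite A B ..
  have [measurable]: "f \<in> borel_measurable A" "g \<in> borel_measurable B"
    using f g by (auto dest: borel_measurable_has_bochner_integral)
  have fi: "integrable A f" and gi: "integrable B g" using f g by (auto simp: has_bochner_integral_iff)
  have int: "integrable (A \<Otimes>\<^sub>M B) (\<lambda>\<omega>. f (fst \<omega>) * g (snd \<omega>))"
    by (rule Fubini_integrable) (use fi gi in \<open>auto simp: abs_mult\<close>)
  moreover have "(\<integral>\<omega>. f (fst \<omega>) * g (snd \<omega>) \<partial>(A \<Otimes>\<^sub>M B)) = a * b"
    using integral_fst'[OF int] f g by (simp add: has_bochner_integral_iff)
  ultimately show ?thesis by (simp add: has_bochner_integral_iff)
qed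

lemma prob_space_v_law: "prob_space (v_law n \<rho>)"
  unfolding v_law_def by (rule prob_space_PiM) (rule prob_space_measure_pmf)

definition sd :: "nat \<times> nat \<Rightarrow> real" where
  "sd e = (if fst e = snd e then sqrt 2 else 1)"

lemma sd_ge_1: "1 \<le> sd e" by (simp add: sd_def)

lemma sd_pos: "0 < sd e" using sd_ge_1[of e] by linarith

lemma W_law_eq: "W_law n = PiM (upper_pairs n) (\<lambda>e. gaussian (sd e))"
  unfolding W_law_def sd_def by (intro arg_cong[where f = "PiM _"]) auto

lemma prob_space_W_law: "prob_space (W_law n)"
  unfolding W_law_eq by (rule prob_space_PiM) (rule prob_space_normal_density[OF sd_pos])

lemma upper_pairs_subset: "upper_pairs n \<subseteq> {0..<n} \<times> {0..<n}"
  by (auto simp: upper_pairs_def)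

lemma finite_upper_pairs: "finite (upper_pairs n)"
  by (rule finite_subset[OF upper_pairs_subset]) simp

lemma prod_of_bool: "finite S \<Longrightarrow> (\<Prod>i\<in>S. of_bool (P i) :: real) = of_bool (\<forall>i\<in>S. P i)"
  by (induction S rule: finite_induct) auto

lemma v_law_moment:
  assumes "0 < \<rho>" "\<rho> < 1" "S \<subseteq> {0..<n}"
  shows "has_bochner_integral (v_law n \<rho>) (\<lambda>v. of_bool (\<forall>i\<in>S. v i)) (\<rho> ^ card S)"
proof -
  interpret product_prob_space "\<lambda>_::nat. measure_pmf (bernoulli_pmf \<rho>)" "{0..<n}"
    by unfold_locales
  define f where "f i b = (if i \<in> S then of_bool b else 1 :: real)" for i :: nat and b
  have int: "integrable (measure_pmf (bernoulli_pmf \<rho>)) (f i)" for i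
    by (rule integrable_measure_pmf_finite) (simp add: finite_subset[OF subset_UNIV])
  have fin: "finite S" using assms(3) finite_subset by blast
  have eq: "(\<Prod>i\<in>{0..<n}. f i (v i)) = of_bool (\<forall>i\<in>S. v i)" for v
  proof -
    have "(\<Prod>i\<in>{0..<n}. f i (v i)) = (\<Prod>i\<in>S. f i (v i))"
      by (rule prod.mono_neutral_right) (use assms in \<open>auto simp: f_def\<close>)
    also have "\<dots> = (\<Prod>i\<in>S. of_bool (v i))" by (simp add: f_def)
    finally show ?thesis using prod_of_bool[OF fin] by simp
  qed
  have "integrable (v_law n \<rho>) (\<lambda>v. \<Prod>i\<in>{0..<n}. f i (v i))"
    unfolding v_law_def by (rule product_integrable_prod) (use int in auto)
  moreover have "(\<integral>v. (\<Prod>i\<in>{0..<n}. f i (v i)) \<partial>v_law n \<rho>) = (\<Prod>i\<in>{0..<n}. \<integral>b. f i b \<partial>bernoulli_pmf \<rho>)"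
    unfolding v_law_def by (rule product_integral_prod) (use int in auto)
  moreover have "\<dots> = (\<Prod>i\<in>S. \<rho>)"
    by (rule prod.mono_neutral_cong_right) (use assms in \<open>auto simp: f_def\<close>)
  ultimately show ?thesis by (simp add: has_bochner_integral_iff eq)
qed

definition hermite_prod :: "(nat \<times> nat) set \<Rightarrow> (nat \<times> nat \<Rightarrow> nat) \<Rightarrow> (nat \<times> nat \<Rightarrow> real) \<Rightarrow> real" where
  "hermite_prod E \<alpha> y = (\<Prod>e\<in>E. poly (hermite (\<alpha> e)) (y e / sd e))"

definition multi_fact :: "'e set \<Rightarrow> ('e \<Rightarrow> nat) \<Rightarrow> real" where
  "multi_fact E \<alpha> = (\<Prod>e\<in>E. fact (\<alpha> e))"

lemma multi_fact_ge_1: "1 \<le> multi_fact E \<alpha>"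
  unfolding multi_fact_def by (rule prod_ge_1) simp

text \<open>Independence reduces this to orthogonality in one coordinate. Both indices vanish off
  the upper pairs, so distinct indices differ at a coordinate that occurs in the product.\<close>

lemma W_law_hermite:
  assumes "\<alpha> \<in> multi_index (upper_pairs n)" "\<beta> \<in> multi_index (upper_pairs n)"
  shows "has_bochner_integral (W_law n)
    (\<lambda>z. hermite_prod (upper_pairs n) \<alpha> z * hermite_prod (upper_pairs n) \<beta> z)
    (if \<alpha> = \<beta> then multi_fact (upper_pairs n) \<alpha> else 0)"
proof -
  let ?E = "upper_pairs n"
  interpret product_sigma_finite "\<lambda>e. gaussian (sd e)"
    by (rule product_sigma_finite.intro)
      (rule prob_space_imp_sigma_finite[OF prob_space_normal_density[OF sd_pos]])
  define f where "f e z = poly (hermite (\<alpha> e) * hermite (\<beta> e)) (z / sd e)" for e z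
  have int: "integrable (gaussian (sd e)) (f e)" for e
    unfolding f_def by (rule integrable_gaussian_poly[OF sd_pos])
  have val: "(\<integral>z. f e z \<partial>gaussian (sd e)) = (if \<alpha> e = \<beta> e then fact (\<alpha> e) else 0)" for e
    unfolding f_def gauss_mean_def[symmetric] by (rule hermite_orthogonal[OF sd_pos])
  have eq: "(\<Prod>e\<in>?E. f e (z e)) = hermite_prod ?E \<alpha> z * hermite_prod ?E \<beta> z" for z
    by (simp add: f_def hermite_prod_def prod.distrib)
  have "integrable (W_law n) (\<lambda>z. \<Prod>e\<in>?E. f e (z e))"
    unfolding W_law_eq by (rule product_integrable_prod[OF finite_upper_pairs int])
  moreover have "(\<integral>z. (\<Prod>e\<in>?E. f e (z e)) \<partial>W_law n) = (\<Prod>e\<in>?E. if \<alpha> e = \<beta> e then fact (\<alpha> e) else 0)"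
    unfolding W_law_eq val[symmetric] by (rule product_integral_prod[OF finite_upper_pairs int])
  moreover have "\<dots> = (if \<alpha> = \<beta> then multi_fact ?E \<alpha> else 0)"
  proof (cases "\<alpha> = \<beta>")
    case False
    then obtain e where e: "\<alpha> e \<noteq> \<beta> e" by blast
    then have "e \<in> ?E" using multi_indexD[OF assms(1), of e] multi_indexD[OF assms(2), of e] by metis
    then have "(\<Prod>e\<in>?E. if \<alpha> e = \<beta> e then fact (\<alpha> e) else 0 :: real) = 0"
      using e finite_upper_pairs by (intro prod_zero) auto
    then show ?thesis using False by simp
  qed (simp add: multi_fact_def)
  ultimately show ?thesis by (simp add: has_bochner_integral_iff eq)
qed

lemma planted_moment:
  assumes "0 < \<rho>" "\<rho> < 1" "S \<subseteq> {0..<n}"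
    and "\<alpha> \<in> multi_index (upper_pairs n)" "\<beta> \<in> multi_index (upper_pairs n)"
  shows "has_bochner_integral (planted_space n \<rho>)
    (\<lambda>\<omega>. of_bool (\<forall>i\<in>S. fst \<omega> i) *
      (hermite_prod (upper_pairs n) \<alpha> (snd \<omega>) * hermite_prod (upper_pairs n) \<beta> (snd \<omega>)))
    (\<rho> ^ card S * (if \<alpha> = \<beta> then multi_fact (upper_pairs n) \<alpha> else 0))"
  unfolding planted_space_def
  by (rule has_bochner_integral_pair_mult[OF prob_space_v_law prob_space_W_law
        v_law_moment[OF assms(1-3)] W_law_hermite[OF assms(4,5)]])

lemma hermite_prod_zero [simp]: "hermite_prod E (\<lambda>_. 0) y = 1"
  by (simp add: hermite_prod_def)

definition signal_weight :: "nat \<Rightarrow> real \<Rightarrow> (nat \<times> nat \<Rightarrow> nat) \<Rightarrow> real" where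
  "signal_weight n lam \<gamma> = (\<Prod>e\<in>upper_pairs n. (lam / sd e) ^ \<gamma> e)"

text \<open>The shift formula in every coordinate, the shift being the normalised signal. A monomial
  in the 0/1 signal entries collapses to the indicator that all vertices of its multigraph carry a
  one; coordinates of exponent 0 impose no condition.\<close>

lemma hermite_prod_Yobs:
  assumes \<alpha>: "\<alpha> \<in> multi_index (upper_pairs n)"
  shows "hermite_prod (upper_pairs n) \<alpha> (Yobs lam \<omega>) =
    (\<Sum>\<beta> | \<beta> \<le> \<alpha>. multi_choose (upper_pairs n) \<alpha> \<beta> * signal_weight n lam (\<lambda>e. \<alpha> e - \<beta> e) *
       (of_bool (\<forall>i\<in>verts (\<lambda>e. \<alpha> e - \<beta> e). fst \<omega> i) * hermite_prod (upper_pairs n) \<beta> (snd \<omega>)))"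
proof -
  let ?E = "upper_pairs n"
  define x where "x e = lam / sd e * of_bool (fst \<omega> (fst e) \<and> fst \<omega> (snd e))" for e
  have Y: "Yobs lam \<omega> e / sd e = snd \<omega> e / sd e + x e" if "e \<in> ?E" for e
    using that by (auto simp: Yobs_def x_def upper_pairs_def add_divide_distrib of_bool_conj)
  have x: "(\<Prod>e\<in>?E. x e ^ \<gamma> e) = signal_weight n lam \<gamma> * of_bool (\<forall>i\<in>verts \<gamma>. fst \<omega> i)"
    if "\<gamma> \<in> multi_index ?E" for \<gamma>
  proof -
    have "(\<Prod>e\<in>?E. x e ^ \<gamma> e) = signal_weight n lam \<gamma> *
        (\<Prod>e\<in>?E. of_bool (0 < \<gamma> e \<longrightarrow> fst \<omega> (fst e) \<and> fst \<omega> (snd e)))"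
      unfolding signal_weight_def prod.distrib[symmetric] x_def
      by (intro prod.cong refl) (auto simp: power_mult_distrib)
    also have "(\<Prod>e\<in>?E. of_bool (0 < \<gamma> e \<longrightarrow> fst \<omega> (fst e) \<and> fst \<omega> (snd e)) :: real) =
        of_bool (\<forall>e\<in>?E. 0 < \<gamma> e \<longrightarrow> fst \<omega> (fst e) \<and> fst \<omega> (snd e))"
      by (rule prod_of_bool[OF finite_upper_pairs])
    also have "(\<forall>e\<in>?E. 0 < \<gamma> e \<longrightarrow> fst \<omega> (fst e) \<and> fst \<omega> (snd e)) \<longleftrightarrow> (\<forall>i\<in>verts \<gamma>. fst \<omega> i)"
    proof -
      have "e \<in> ?E" if "0 < \<gamma> e" for e using multi_indexD[OF \<open>\<gamma> \<in> multi_index ?E\<close>] that by (metis less_irrefl)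
      then show ?thesis unfolding verts_def by blast
    qed
    finally show ?thesis .
  qed
  have "hermite_prod ?E \<alpha> (Yobs lam \<omega>) =
      (\<Prod>e\<in>?E. \<Sum>b\<le>\<alpha> e. real (\<alpha> e choose b) * x e ^ (\<alpha> e - b) * poly (hermite b) (snd \<omega> e / sd e))"
    unfolding hermite_prod_def by (intro prod.cong refl) (simp only: Y hermite_shift)
  also have "\<dots> = (\<Sum>\<beta> | \<beta> \<le> \<alpha>. multi_choose ?E \<alpha> \<beta> * (\<Prod>e\<in>?E. x e ^ (\<alpha> e - \<beta> e)) * hermite_prod ?E \<beta> (snd \<omega>))"
    unfolding prod_sum_below[OF finite_upper_pairs \<alpha>] multi_choose_def hermite_prod_def prod.distrib ..
  finally show ?thesis by (simp only: x[OF multi_index_diff[OF \<alpha>]] mult.assoc)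
qed

lemma verts_bound:
  assumes "\<gamma> \<in> multi_index (upper_pairs n)"
  shows "verts \<gamma> \<subseteq> {0..<n}"
proof -
  have "fst e < n \<and> snd e < n" if "0 < \<gamma> e" for e
  proof -
    have "e \<in> upper_pairs n" using multi_indexD[OF assms, of e] that by (metis less_irrefl)
    then show ?thesis by (auto simp: upper_pairs_def)
  qed
  then show ?thesis unfolding verts_def by auto
qed

section \<open>Random variables with integrable products, and observed polynomials in Hermite
  form\<close>

definition rv_basis :: "nat \<Rightarrow> ((nat \<Rightarrow> bool) \<times> (nat \<times> nat \<Rightarrow> real) \<Rightarrow> real) set" where
  "rv_basis n = {\<lambda>\<omega>. of_bool (\<forall>i\<in>S. fst \<omega> i) * hermite_prod (upper_pairs n) \<beta> (snd \<omega>) | S \<beta>.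
     S \<subseteq> {0..<n} \<and> \<beta> \<in> multi_index (upper_pairs n)}"

text \<open>The indicators of \<open>S\<close> and \<open>T\<close> multiply to that of
  \<open>S \<union> T\<close>, so a product of two generators is covered by
  \<open>planted_moment\<close>. Target, observed polynomials and certificate all lie in this span,
  which settles the integrability questions of the lower bound.\<close>

lemma integrable_rv_mult:
  assumes rho: "0 < \<rho>" "\<rho> < 1" and f: "f \<in> fspan (rv_basis n)" and g: "g \<in> fspan (rv_basis n)"
  shows "integrable (planted_space n \<rho>) (\<lambda>\<omega>. f \<omega> * g \<omega>)"
  using f
proof induction
  case (base f)
  from g show ?case
  proof induction
    case (base g)
    obtain S \<alpha> T \<beta> where *: "S \<subseteq> {0..<n}" "\<alpha> \<in> multi_index (upper_pairs n)"
        "f = (\<lambda>\<omega>. of_bool (\<forall>i\<in>S. fst \<omega> i) * hermite_prod (upper_pairs n) \<alpha> (snd \<omega>))"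
        "T \<subseteq> {0..<n}" "\<beta> \<in> multi_index (upper_pairs n)"
        "g = (\<lambda>\<omega>. of_bool (\<forall>i\<in>T. fst \<omega> i) * hermite_prod (upper_pairs n) \<beta> (snd \<omega>))"
      using base \<open>f \<in> rv_basis n\<close> unfolding rv_basis_def by blast
    have "S \<union> T \<subseteq> {0..<n}" using * by blast
    from planted_moment[OF rho this *(2) *(5)]
    have "integrable (planted_space n \<rho>) (\<lambda>\<omega>. of_bool (\<forall>i\<in>S \<union> T. fst \<omega> i) *
      (hermite_prod (upper_pairs n) \<alpha> (snd \<omega>) * hermite_prod (upper_pairs n) \<beta> (snd \<omega>)))"
      by (rule has_bochner_integral_iff[THEN iffD1, THEN conjunct1])
    moreover have "(\<lambda>\<omega>. of_bool (\<forall>i\<in>S \<union> T. fst \<omega> i) *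
      (hermite_prod (upper_pairs n) \<alpha> (snd \<omega>) * hermite_prod (upper_pairs n) \<beta> (snd \<omega>))) = (\<lambda>\<omega>. f \<omega> * g \<omega>)"
      unfolding *(3,6) by (auto simp: fun_eq_iff)
    ultimately show ?case by simp
  qed (simp_all add: distrib_left mult.left_commute)
qed (simp_all add: distrib_right mult.assoc)

lemma rv_target: "n \<ge> 1 \<Longrightarrow> (\<lambda>\<omega>. of_bool (fst \<omega> 0)) \<in> fspan (rv_basis n)"
proof (rule fspan.base)
  assume "n \<ge> 1"
  then have "(\<lambda>\<omega>. of_bool (\<forall>i\<in>{0}. fst \<omega> i) * hermite_prod (upper_pairs n) (\<lambda>_. 0) (snd \<omega>)) \<in> rv_basis n"
    unfolding rv_basis_def by (intro CollectI exI[of _ "{0}"] exI[of _ "\<lambda>_. 0"]) (auto simp: multi_index_def)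
  then show "(\<lambda>\<omega>. of_bool (fst \<omega> 0)) \<in> rv_basis n" by simp
qed

lemma rv_noise:
  assumes "\<beta> \<in> multi_index (upper_pairs n)"
  shows "(\<lambda>\<omega>. hermite_prod (upper_pairs n) \<beta> (snd \<omega>)) \<in> fspan (rv_basis n)"
proof (rule fspan.base)
  have "(\<lambda>\<omega>. of_bool (\<forall>i\<in>{}. fst \<omega> i) * hermite_prod (upper_pairs n) \<beta> (snd \<omega>)) \<in> rv_basis n"
    unfolding rv_basis_def using assms by (intro CollectI exI[of _ "{}"] exI[of _ \<beta>]) auto
  then show "(\<lambda>\<omega>. hermite_prod (upper_pairs n) \<beta> (snd \<omega>)) \<in> rv_basis n" by simp
qed

lemma rv_observation:
  assumes \<alpha>: "\<alpha> \<in> multi_index (upper_pairs n)"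
  shows "(\<lambda>\<omega>. hermite_prod (upper_pairs n) \<alpha> (Yobs lam \<omega>)) \<in> fspan (rv_basis n)"
  unfolding hermite_prod_Yobs[OF \<alpha>]
proof (intro fspan_sum fspan.scale fspan.base)
  fix \<beta> assume "\<beta> \<in> {\<beta>. \<beta> \<le> \<alpha>}"
  then show "(\<lambda>\<omega>. of_bool (\<forall>i\<in>verts (\<lambda>e. \<alpha> e - \<beta> e). fst \<omega> i) * hermite_prod (upper_pairs n) \<beta> (snd \<omega>)) \<in> rv_basis n"
    unfolding rv_basis_def using multi_index_le[OF \<alpha>] verts_bound[OF multi_index_diff[OF \<alpha>]] by blast
qed

definition hermite_basis :: "nat \<Rightarrow> nat \<Rightarrow> ((nat \<times> nat \<Rightarrow> real) \<Rightarrow> real) set" where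
  "hermite_basis n d = hermite_prod (upper_pairs n) `
     {\<alpha> \<in> multi_index (upper_pairs n). sum \<alpha> (upper_pairs n) \<le> d}"

lemma hermite_basis_mono: "d \<le> d' \<Longrightarrow> f \<in> fspan (hermite_basis n d) \<Longrightarrow> f \<in> fspan (hermite_basis n d')"
  by (rule fspan_mono[rotated]) (auto simp: hermite_basis_def)

text \<open>The three-term recurrence in one coordinate. At \<open>\<alpha> e = 0\<close> the
  truncated index \<open>\<alpha> e - 1\<close> is harmless because its coefficient
  vanishes.\<close>

lemma mult_hermite_prod:
  assumes "finite E" "e \<in> E"
  shows "y e * hermite_prod E \<alpha> y = sd e * hermite_prod E (\<alpha>(e := Suc (\<alpha> e))) y
    + sd e * real (\<alpha> e) * hermite_prod E (\<alpha>(e := \<alpha> e - 1)) y"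
proof -
  define P where "P = (\<Prod>i\<in>E - {e}. poly (hermite (\<alpha> i)) (y i / sd i))"
  define t where "t = y e / sd e"
  have split: "hermite_prod E \<beta> y = poly (hermite (\<beta> e)) t * P" if "\<And>i. i \<noteq> e \<Longrightarrow> \<beta> i = \<alpha> i" for \<beta>
  proof -
    have "(\<Prod>i\<in>E - {e}. poly (hermite (\<beta> i)) (y i / sd i)) = P"
      unfolding P_def using that by (intro prod.cong) auto
    then show ?thesis unfolding hermite_prod_def prod.remove[OF assms] by (simp add: t_def)
  qed
  have y: "y e = sd e * t" using sd_pos[of e] by (simp add: t_def)
  have "t * poly (hermite (\<alpha> e)) t = poly (hermite (Suc (\<alpha> e))) t + real (\<alpha> e) * poly (hermite (\<alpha> e - 1)) t"
    by (simp add: poly_hermite_Suc del: hermite.simps)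
  then have "sd e * (t * poly (hermite (\<alpha> e)) t) * P =
      sd e * (poly (hermite (Suc (\<alpha> e))) t + real (\<alpha> e) * poly (hermite (\<alpha> e - 1)) t) * P" by simp
  then show ?thesis
    by (simp only: split[of \<alpha>] split[of "\<alpha>(e := Suc (\<alpha> e))"] split[of "\<alpha>(e := \<alpha> e - 1)"] y
        fun_upd_apply refl if_True if_False algebra_simps)
qed

lemma hermite_span_mult:
  assumes e: "e \<in> upper_pairs n" and f: "f \<in> fspan (hermite_basis n d)"
  shows "(\<lambda>y. y e * f y) \<in> fspan (hermite_basis n (Suc d))"
  using f
proof induction
  case (base f)
  let ?E = "upper_pairs n"
  obtain \<alpha> where \<alpha>: "\<alpha> \<in> multi_index ?E" "sum \<alpha> ?E \<le> d" "f = hermite_prod ?E \<alpha>"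
    using base unfolding hermite_basis_def by blast
  note fin = finite_upper_pairs[of n]
  have m: "\<alpha>(e := k) \<in> multi_index ?E" for k using \<alpha>(1) e by (auto simp: multi_index_def)
  have s: "sum (\<alpha>(e := k)) ?E = k + sum \<alpha> (?E - {e})" for k
    unfolding sum.remove[OF fin e] by (auto intro!: sum.cong)
  have s0: "sum \<alpha> ?E = \<alpha> e + sum \<alpha> (?E - {e})" by (rule sum.remove[OF fin e])
  have in_span: "hermite_prod ?E (\<alpha>(e := k)) \<in> fspan (hermite_basis n (Suc d))" if "k \<le> Suc (\<alpha> e)" for k
  proof -
    have "sum (\<alpha>(e := k)) ?E \<le> Suc d" using s[of k] s0 \<alpha>(2) that by linarith
    then show ?thesis unfolding hermite_basis_def using m[of k] by (intro fspan.base imageI) blast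
  qed
  have "(\<lambda>y. sd e * hermite_prod ?E (\<alpha>(e := Suc (\<alpha> e))) y
    + sd e * real (\<alpha> e) * hermite_prod ?E (\<alpha>(e := \<alpha> e - 1)) y) \<in> fspan (hermite_basis n (Suc d))"
    by (intro fspan.add fspan.scale in_span) auto
  then show ?case unfolding \<alpha>(3) mult_hermite_prod[OF fin e] .
next
  case zero
  then show ?case using fspan.zero by simp
next
  case (add f g)
  then show ?case using fspan.add[OF add.IH] by (simp add: distrib_left)
next
  case (scale f c)
  then show ?case using fspan.scale[OF scale.IH, of c] by (simp add: mult.left_commute)
qed

text \<open>Monomials use all ordered pairs, the Hermite basis only upper ones. Symmetry of
  \<open>Y\<close> lets an entry be replaced by its mirror image, which is why the equality is
  stated along \<open>Yobs\<close>.\<close>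

lemma monomial_hermite_span:
  assumes "set_mset m \<subseteq> {0..<n} \<times> {0..<n}"
  shows "\<exists>f\<in>fspan (hermite_basis n (size m)).
    \<forall>\<omega>. prod_mset (image_mset (Yobs lam \<omega>) m) = f (Yobs lam \<omega>)"
  using assms
proof (induction m)
  case empty
  have "hermite_prod (upper_pairs n) (\<lambda>_. 0) \<in> fspan (hermite_basis n 0)"
    unfolding hermite_basis_def by (intro fspan.base imageI) (auto simp: multi_index_def)
  then show ?case by (intro bexI[of _ "hermite_prod (upper_pairs n) (\<lambda>_. 0)"]) auto
next
  case (add p m)
  then obtain f where f: "f \<in> fspan (hermite_basis n (size m))"
    "\<And>\<omega>. prod_mset (image_mset (Yobs lam \<omega>) m) = f (Yobs lam \<omega>)" by auto
  define e where "e = (min (fst p) (snd p), max (fst p) (snd p))"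
  have e: "e \<in> upper_pairs n" using add.prems by (auto simp: e_def upper_pairs_def)
  have Y: "Yobs lam \<omega> p = Yobs lam \<omega> e" for \<omega>
    by (auto simp: Yobs_def e_def min_def max_def)
  show ?case
  proof (rule bexI[of _ "\<lambda>y. y e * f y"])
    show "(\<lambda>y. y e * f y) \<in> fspan (hermite_basis n (size (add_mset p m)))"
      using hermite_span_mult[OF e f(1)] by simp
    show "\<forall>\<omega>. prod_mset (image_mset (Yobs lam \<omega>) (add_mset p m)) = Yobs lam \<omega> e * f (Yobs lam \<omega>)"
      by (simp add: Y f(2))
  qed
qed

lemma polyval_hermite_span:
  "\<exists>f\<in>fspan (hermite_basis n D). \<forall>\<omega>. polyval n D c (Yobs lam \<omega>) = f (Yobs lam \<omega>)"
proof -
  have "\<forall>m\<in>monomials n D. \<exists>f\<in>fspan (hermite_basis n D).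
    \<forall>\<omega>. prod_mset (image_mset (Yobs lam \<omega>) m) = f (Yobs lam \<omega>)"
    using monomial_hermite_span hermite_basis_mono unfolding monomials_def by (metis (mono_tags, lifting) mem_Collect_eq)
  then obtain F where F: "\<And>m. m \<in> monomials n D \<Longrightarrow> F m \<in> fspan (hermite_basis n D)"
    "\<And>m \<omega>. m \<in> monomials n D \<Longrightarrow> prod_mset (image_mset (Yobs lam \<omega>) m) = F m (Yobs lam \<omega>)"
    by metis
  show ?thesis
  proof (rule bexI[of _ "\<lambda>y. \<Sum>m\<in>monomials n D. c m * F m y"])
    show "(\<lambda>y. \<Sum>m\<in>monomials n D. c m * F m y) \<in> fspan (hermite_basis n D)"
      by (intro fspan_sum fspan.scale F(1))
    show "\<forall>\<omega>. polyval n D c (Yobs lam \<omega>) = (\<Sum>m\<in>monomials n D. c m * F m (Yobs lam \<omega>))"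
      by (simp add: polyval_def F(2))
  qed
qed

text \<open>The dual certificate: correlating an observable polynomial with this function of the noise
  alone gives the same value as correlating it with the target.\<close>

definition dual_cert :: "nat \<Rightarrow> real \<Rightarrow> real \<Rightarrow> nat \<Rightarrow> (nat \<times> nat \<Rightarrow> real) \<Rightarrow> real" where
  "dual_cert n lam \<rho> D z =
     (\<Sum>\<beta> | \<beta> \<in> multi_index (upper_pairs n) \<and> sum \<beta> (upper_pairs n) \<le> D.
        (signal_weight n lam \<beta> * cumul (upper_pairs n) \<rho> \<beta> / multi_fact (upper_pairs n) \<beta>)
        * hermite_prod (upper_pairs n) \<beta> z)"

lemma finite_multi_index_le:
  assumes "finite E" shows "finite {\<beta>. \<beta> \<in> multi_index E \<and> sum \<beta> E \<le> D}"
proof -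
  have "{\<beta>. \<beta> \<in> multi_index E \<and> sum \<beta> E \<le> D} = (\<Union>d\<in>{..D}. {\<beta> \<in> multi_index E. sum \<beta> E = d})" by auto
  then show ?thesis using multi_index_card_le[OF assms] by simp
qed

lemma signal_weight_add:
  "\<beta> \<le> \<alpha> \<Longrightarrow> signal_weight n lam (\<lambda>e. \<alpha> e - \<beta> e) * signal_weight n lam \<beta> = signal_weight n lam \<alpha>"
  unfolding signal_weight_def prod.distrib[symmetric] power_add[symmetric]
  by (intro prod.cong refl) (simp add: le_funD)

text \<open>Hermite products of the noise of nonzero index have mean zero, so only
  \<open>\<beta> = 0\<close> survives from the shift expansion, and the full signal monomial remains
  next to the target.\<close>

lemma observation_target_moment:
  assumes n: "n \<ge> 1" and rho: "0 < \<rho>" "\<rho> < 1" and \<alpha>: "\<alpha> \<in> multi_index (upper_pairs n)"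
  shows "(\<integral>\<omega>. hermite_prod (upper_pairs n) \<alpha> (Yobs lam \<omega>) * of_bool (fst \<omega> 0) \<partial>planted_space n \<rho>)
    = signal_weight n lam \<alpha> * \<rho> ^ card (insert 0 (verts \<alpha>))"
proof -
  let ?E = "upper_pairs n" and ?M = "planted_space n \<rho>"
  define C where "C \<beta> = multi_choose ?E \<alpha> \<beta> * signal_weight n lam (\<lambda>e. \<alpha> e - \<beta> e)" for \<beta>
  define V where "V \<beta> = insert 0 (verts (\<lambda>e. \<alpha> e - \<beta> e))" for \<beta>
  let ?z = "\<lambda>_. 0 :: nat"
  have z: "?z \<in> multi_index ?E" by (simp add: multi_index_def)
  have mom: "has_bochner_integral ?M (\<lambda>\<omega>. of_bool (\<forall>i\<in>V \<beta>. fst \<omega> i) *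
      (hermite_prod ?E \<beta> (snd \<omega>) * hermite_prod ?E ?z (snd \<omega>)))
      (\<rho> ^ card (V \<beta>) * (if \<beta> = ?z then multi_fact ?E \<beta> else 0))" if "\<beta> \<le> \<alpha>" for \<beta>
  proof (rule planted_moment[OF rho _ multi_index_le[OF \<alpha> that] z])
    show "V \<beta> \<subseteq> {0..<n}" using n verts_bound[OF multi_index_diff[OF \<alpha>]] by (auto simp: V_def)
  qed
  have eq: "hermite_prod ?E \<alpha> (Yobs lam \<omega>) * of_bool (fst \<omega> 0) = (\<Sum>\<beta> | \<beta> \<le> \<alpha>. C \<beta> *
      (of_bool (\<forall>i\<in>V \<beta>. fst \<omega> i) * (hermite_prod ?E \<beta> (snd \<omega>) * hermite_prod ?E ?z (snd \<omega>))))" for \<omega>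
    unfolding hermite_prod_Yobs[OF \<alpha>] sum_distrib_right C_def V_def
    by (intro sum.cong refl) auto
  have "has_bochner_integral ?M (\<lambda>\<omega>. hermite_prod ?E \<alpha> (Yobs lam \<omega>) * of_bool (fst \<omega> 0))
      (\<Sum>\<beta> | \<beta> \<le> \<alpha>. C \<beta> * (\<rho> ^ card (V \<beta>) * (if \<beta> = ?z then multi_fact ?E \<beta> else 0)))"
    unfolding eq by (intro has_bochner_integral_sum has_bochner_integral_mult_right mom) auto
  moreover have "(\<Sum>\<beta> | \<beta> \<le> \<alpha>. C \<beta> * (\<rho> ^ card (V \<beta>) * (if \<beta> = ?z then multi_fact ?E \<beta> else 0))) =
      (\<Sum>\<beta>\<in>{?z}. C \<beta> * (\<rho> ^ card (V \<beta>) * (if \<beta> = ?z then multi_fact ?E \<beta> else 0)))"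
    by (rule sum.mono_neutral_right[OF finite_below_multi_index[OF finite_upper_pairs \<alpha>]])
      (auto simp: le_fun_def)
  ultimately show ?thesis
    by (simp add: has_bochner_integral_iff C_def V_def multi_choose_zero multi_fact_def)
qed

text \<open>Orthogonality pairs each term of the shift expansion with one term of the certificate,
  and the division by \<open>multi_fact\<close> cancels the Hermite norm. What remains is
  \<open>cumul_moment\<close>. The degree bound ensures that every
  \<open>\<beta> \<le> \<alpha>\<close> occurs in the certificate.\<close>

lemma observation_dual_moment:
  assumes rho: "0 < \<rho>" "\<rho> < 1" and \<alpha>: "\<alpha> \<in> multi_index (upper_pairs n)"
    and deg: "sum \<alpha> (upper_pairs n) \<le> D"
  shows "(\<integral>\<omega>. hermite_prod (upper_pairs n) \<alpha> (Yobs lam \<omega>) * dual_cert n lam \<rho> D (snd \<omega>) \<partial>planted_space n \<rho>)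
    = signal_weight n lam \<alpha> * \<rho> ^ card (insert 0 (verts \<alpha>))"
proof -
  let ?E = "upper_pairs n" and ?M = "planted_space n \<rho>"
  let ?I = "{\<beta>. \<beta> \<in> multi_index ?E \<and> sum \<beta> ?E \<le> D}"
  define C where "C \<beta> = multi_choose ?E \<alpha> \<beta> * signal_weight n lam (\<lambda>e. \<alpha> e - \<beta> e)" for \<beta>
  define K where "K \<gamma> = signal_weight n lam \<gamma> * cumul ?E \<rho> \<gamma> / multi_fact ?E \<gamma>" for \<gamma>
  define V where "V \<beta> = verts (\<lambda>e. \<alpha> e - \<beta> e)" for \<beta>
  have finI: "finite ?I" by (rule finite_multi_index_le[OF finite_upper_pairs])
  have mom: "has_bochner_integral ?M (\<lambda>\<omega>. of_bool (\<forall>i\<in>V \<beta>. fst \<omega> i) *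
      (hermite_prod ?E \<beta> (snd \<omega>) * hermite_prod ?E \<gamma> (snd \<omega>)))
      (\<rho> ^ card (V \<beta>) * (if \<beta> = \<gamma> then multi_fact ?E \<beta> else 0))" if "\<beta> \<le> \<alpha>" "\<gamma> \<in> ?I" for \<beta> \<gamma>
    by (rule planted_moment[OF rho _ multi_index_le[OF \<alpha> that(1)]])
      (use that verts_bound[OF multi_index_diff[OF \<alpha>]] in \<open>auto simp: V_def\<close>)
  have eq: "hermite_prod ?E \<alpha> (Yobs lam \<omega>) * dual_cert n lam \<rho> D (snd \<omega>) = (\<Sum>\<beta> | \<beta> \<le> \<alpha>. \<Sum>\<gamma>\<in>?I. C \<beta> * K \<gamma> *
      (of_bool (\<forall>i\<in>V \<beta>. fst \<omega> i) * (hermite_prod ?E \<beta> (snd \<omega>) * hermite_prod ?E \<gamma> (snd \<omega>))))" for \<omega>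
    unfolding hermite_prod_Yobs[OF \<alpha>] dual_cert_def sum_product C_def V_def K_def
    by (intro sum.cong refl) (simp only: mult_ac)
  have "has_bochner_integral ?M (\<lambda>\<omega>. hermite_prod ?E \<alpha> (Yobs lam \<omega>) * dual_cert n lam \<rho> D (snd \<omega>))
      (\<Sum>\<beta> | \<beta> \<le> \<alpha>. \<Sum>\<gamma>\<in>?I. C \<beta> * K \<gamma> * (\<rho> ^ card (V \<beta>) * (if \<beta> = \<gamma> then multi_fact ?E \<beta> else 0)))"
    unfolding eq by (intro has_bochner_integral_sum has_bochner_integral_mult_right mom) auto
  moreover have "(\<Sum>\<gamma>\<in>?I. C \<beta> * K \<gamma> * (\<rho> ^ card (V \<beta>) * (if \<beta> = \<gamma> then multi_fact ?E \<beta> else 0))) =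
      signal_weight n lam \<alpha> * (multi_choose ?E \<alpha> \<beta> * cumul ?E \<rho> \<beta> * \<rho> ^ card (V \<beta>))" if "\<beta> \<le> \<alpha>" for \<beta>
  proof -
    have "sum \<beta> ?E \<le> sum \<alpha> ?E" using that by (intro sum_mono) (simp add: le_funD)
    then have I: "\<beta> \<in> ?I" using multi_index_le[OF \<alpha> that] deg by simp
    have "(\<Sum>\<gamma>\<in>?I. C \<beta> * K \<gamma> * (\<rho> ^ card (V \<beta>) * (if \<beta> = \<gamma> then multi_fact ?E \<beta> else 0))) =
        (\<Sum>\<gamma>\<in>{\<beta>}. C \<beta> * K \<gamma> * (\<rho> ^ card (V \<beta>) * (if \<beta> = \<gamma> then multi_fact ?E \<beta> else 0)))"
      by (rule sum.mono_neutral_right[OF finI]) (use I in auto)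
    also have "\<dots> = C \<beta> * (K \<beta> * multi_fact ?E \<beta>) * \<rho> ^ card (V \<beta>)" by simp
    also have "K \<beta> * multi_fact ?E \<beta> = signal_weight n lam \<beta> * cumul ?E \<rho> \<beta>"
      using multi_fact_ge_1[of ?E \<beta>] by (simp add: K_def)
    finally show ?thesis unfolding C_def signal_weight_add[OF that, symmetric] by (simp only: mult_ac)
  qed
  ultimately show ?thesis
    using cumul_moment[OF finite_upper_pairs \<alpha>, of \<rho>]
    by (simp add: has_bochner_integral_iff V_def sum_distrib_left[symmetric])
qed

lemma rv_dual: "(\<lambda>\<omega>. dual_cert n lam \<rho> D (snd \<omega>)) \<in> fspan (rv_basis n)"
  unfolding dual_cert_def by (intro fspan_sum fspan.scale rv_noise) auto

lemma dual_square_moment: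
  assumes rho: "0 < \<rho>" "\<rho> < 1"
  shows "(\<integral>\<omega>. dual_cert n lam \<rho> D (snd \<omega>) * dual_cert n lam \<rho> D (snd \<omega>) \<partial>planted_space n \<rho>) =
    (\<Sum>\<beta> | \<beta> \<in> multi_index (upper_pairs n) \<and> sum \<beta> (upper_pairs n) \<le> D.
      (signal_weight n lam \<beta> * cumul (upper_pairs n) \<rho> \<beta>)\<^sup>2 / multi_fact (upper_pairs n) \<beta>)"
proof -
  let ?E = "upper_pairs n" and ?M = "planted_space n \<rho>"
  let ?I = "{\<beta>. \<beta> \<in> multi_index ?E \<and> sum \<beta> ?E \<le> D}"
  define K where "K \<gamma> = signal_weight n lam \<gamma> * cumul ?E \<rho> \<gamma> / multi_fact ?E \<gamma>" for \<gamma>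
  have finI: "finite ?I" by (rule finite_multi_index_le[OF finite_upper_pairs])
  have mom: "has_bochner_integral ?M (\<lambda>\<omega>. hermite_prod ?E \<beta> (snd \<omega>) * hermite_prod ?E \<gamma> (snd \<omega>))
      (if \<beta> = \<gamma> then multi_fact ?E \<beta> else 0)" if "\<beta> \<in> ?I" "\<gamma> \<in> ?I" for \<beta> \<gamma>
    using planted_moment[OF rho, of "{}" n \<beta> \<gamma>] that by simp
  have eq: "dual_cert n lam \<rho> D (snd \<omega>) * dual_cert n lam \<rho> D (snd \<omega>) = (\<Sum>\<beta>\<in>?I. \<Sum>\<gamma>\<in>?I. K \<beta> * K \<gamma> *
      (hermite_prod ?E \<beta> (snd \<omega>) * hermite_prod ?E \<gamma> (snd \<omega>)))" for \<omega> :: "(nat \<Rightarrow> bool) \<times> (nat \<times> nat \<Rightarrow> real)"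
    unfolding dual_cert_def sum_product K_def by (intro sum.cong refl) (simp only: mult_ac)
  have "has_bochner_integral ?M (\<lambda>\<omega>. dual_cert n lam \<rho> D (snd \<omega>) * dual_cert n lam \<rho> D (snd \<omega>))
      (\<Sum>\<beta>\<in>?I. \<Sum>\<gamma>\<in>?I. K \<beta> * K \<gamma> * (if \<beta> = \<gamma> then multi_fact ?E \<beta> else 0))"
    unfolding eq by (intro has_bochner_integral_sum has_bochner_integral_mult_right mom) auto
  moreover have "(\<Sum>\<gamma>\<in>?I. K \<beta> * K \<gamma> * (if \<beta> = \<gamma> then multi_fact ?E \<beta> else 0)) =
      (signal_weight n lam \<beta> * cumul ?E \<rho> \<beta>)\<^sup>2 / multi_fact ?E \<beta>" if "\<beta> \<in> ?I" for \<beta>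
  proof -
    have "(\<Sum>\<gamma>\<in>?I. K \<beta> * K \<gamma> * (if \<beta> = \<gamma> then multi_fact ?E \<beta> else 0)) =
        (\<Sum>\<gamma>\<in>{\<beta>}. K \<beta> * K \<gamma> * (if \<beta> = \<gamma> then multi_fact ?E \<beta> else 0))"
      by (rule sum.mono_neutral_right[OF finI]) (use that in auto)
    then show ?thesis using multi_fact_ge_1[of ?E \<beta>] by (simp add: K_def power2_eq_square)
  qed
  ultimately show ?thesis by (simp add: has_bochner_integral_iff)
qed

text \<open>Standard deviations and factorials are at least 1, so the norm is dominated by the sum
  of squared cumulants that was bounded by counting.\<close>

lemma dual_square_moment_le:
  assumes rho: "0 < \<rho>" "\<rho> < 1" and n: "n \<ge> 1" and lam: "0 \<le> lam"
    and r: "0 < r" "r < 1" and D: "D \<ge> 1"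
    and le: "lam \<le> r / (real D * (real D + 1)) * min 1 (1 / (\<rho> * sqrt (real n)))"
  shows "(\<integral>\<omega>. dual_cert n lam \<rho> D (snd \<omega>) * dual_cert n lam \<rho> D (snd \<omega>) \<partial>planted_space n \<rho>)
    \<le> \<rho>\<^sup>2 / (1 - r\<^sup>2)\<^sup>2"
proof -
  let ?E = "upper_pairs n"
  have w: "0 \<le> signal_weight n lam \<beta> \<and> signal_weight n lam \<beta> \<le> lam ^ sum \<beta> ?E" for \<beta>
    unfolding signal_weight_def power_sum
  proof (intro conjI prod_nonneg ballI prod_mono)
    fix e
    have "lam / sd e \<le> lam" "0 \<le> lam / sd e"
      using mult_left_mono[OF sd_ge_1[of e] lam] sd_pos[of e] lam by (auto simp: field_simps)
    then show "0 \<le> (lam / sd e) ^ \<beta> e" "0 \<le> (lam / sd e) ^ \<beta> e" "(lam / sd e) ^ \<beta> e \<le> lam ^ \<beta> e"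
      by (auto intro: power_mono)
  qed
  have "(signal_weight n lam \<beta> * cumul ?E \<rho> \<beta>)\<^sup>2 / multi_fact ?E \<beta> \<le> (lam ^ sum \<beta> ?E * cumul ?E \<rho> \<beta>)\<^sup>2" for \<beta>
  proof -
    have "(signal_weight n lam \<beta> * cumul ?E \<rho> \<beta>)\<^sup>2 / multi_fact ?E \<beta> \<le> (signal_weight n lam \<beta> * cumul ?E \<rho> \<beta>)\<^sup>2 / 1"
      using multi_fact_ge_1[of ?E \<beta>] by (intro divide_left_mono) auto
    also have "\<dots> \<le> (lam ^ sum \<beta> ?E * cumul ?E \<rho> \<beta>)\<^sup>2"
      unfolding div_by_1 power_mult_distrib using w[of \<beta>] by (intro mult_right_mono power_mono) auto
    finally show ?thesis .
  qed
  then have "(\<Sum>\<beta> | \<beta> \<in> multi_index ?E \<and> sum \<beta> ?E \<le> D. (signal_weight n lam \<beta> * cumul ?E \<rho> \<beta>)\<^sup>2 / multi_fact ?E \<beta>)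
      \<le> (\<Sum>\<beta> | \<beta> \<in> multi_index ?E \<and> sum \<beta> ?E \<le> D. (lam ^ sum \<beta> ?E * cumul ?E \<rho> \<beta>)\<^sup>2)"
    by (intro sum_mono)
  also have "\<dots> \<le> \<rho>\<^sup>2 / (1 - r\<^sup>2)\<^sup>2"
    by (rule sum_cumul_square_le[OF upper_pairs_subset n rho r lam D le])
  finally show ?thesis unfolding dual_square_moment[OF rho] .
qed

text \<open>The identity is linear in \<open>f\<close>, so Hermite products suffice. Membership in
  the span travels along in the induction because splitting the integral of a sum requires
  integrability.\<close>

lemma dual_certificate:
  assumes n: "n \<ge> 1" and rho: "0 < \<rho>" "\<rho> < 1" and f: "f \<in> fspan (hermite_basis n D)"
  shows "(\<lambda>\<omega>. f (Yobs lam \<omega>)) \<in> fspan (rv_basis n) \<and>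
    (\<integral>\<omega>. f (Yobs lam \<omega>) * of_bool (fst \<omega> 0) \<partial>planted_space n \<rho>) =
    (\<integral>\<omega>. f (Yobs lam \<omega>) * dual_cert n lam \<rho> D (snd \<omega>) \<partial>planted_space n \<rho>)"
  using f
proof induction
  case (base f)
  then obtain \<alpha> where \<alpha>: "\<alpha> \<in> multi_index (upper_pairs n)" "sum \<alpha> (upper_pairs n) \<le> D"
    "f = hermite_prod (upper_pairs n) \<alpha>" unfolding hermite_basis_def by blast
  show ?case
    unfolding \<alpha>(3) observation_target_moment[OF n rho \<alpha>(1)] observation_dual_moment[OF rho \<alpha>(1,2)]
    using rv_observation[OF \<alpha>(1)] by simp
next
  case zero
  show ?case by (simp add: fspan.zero)
next
  case (add f g)
  then show ?case
    by (simp add: distrib_right fspan.add integrable_rv_mult[OF rho] rv_target[OF n] rv_dual)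
next
  case (scale f c)
  then show ?case by (simp add: mult.assoc fspan.scale)
qed

section \<open>The lower bound\<close>

lemma MMSE_lower_bound:
  assumes rho: "0 < \<rho>" "\<rho> < 1" and n: "n \<ge> 1" and lam: "0 \<le> lam"
    and r: "0 < r" "r < 1" and D: "D \<ge> 1"
    and le: "lam \<le> r / (real D * (real D + 1)) * min 1 (1 / (\<rho> * sqrt (real n)))"
  shows "ennreal (\<rho> - \<rho>\<^sup>2 / (1 - r\<^sup>2)\<^sup>2) \<le> MMSE n lam \<rho> D"
  unfolding MMSE_def
proof (rule INF_greatest)
  fix c
  let ?M = "planted_space n \<rho>"
  obtain f where f: "f \<in> fspan (hermite_basis n D)" "\<And>\<omega>. polyval n D c (Yobs lam \<omega>) = f (Yobs lam \<omega>)"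
    using polyval_hermite_span by blast
  define F where "F \<omega> = f (Yobs lam \<omega>)" for \<omega>
  define X where "X \<omega> = (of_bool (fst \<omega> 0) :: real)" for \<omega> :: "(nat \<Rightarrow> bool) \<times> (nat \<times> nat \<Rightarrow> real)"
  define W where "W \<omega> = dual_cert n lam \<rho> D (snd \<omega>)" for \<omega> :: "(nat \<Rightarrow> bool) \<times> (nat \<times> nat \<Rightarrow> real)"
  have F: "F \<in> fspan (rv_basis n)" and FX: "(\<integral>\<omega>. F \<omega> * X \<omega> \<partial>?M) = (\<integral>\<omega>. F \<omega> * W \<omega> \<partial>?M)"
    using dual_certificate[OF n rho f(1), of lam] unfolding F_def X_def W_def by auto
  have X: "X \<in> fspan (rv_basis n)" using rv_target[OF n] unfolding X_def .
  have W: "W \<in> fspan (rv_basis n)" using rv_dual unfolding W_def .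
  note int = integrable_rv_mult[OF rho]
  have XX: "(\<integral>\<omega>. X \<omega> * X \<omega> \<partial>?M) = \<rho>"
  proof -
    have "has_bochner_integral ?M X \<rho>"
      using planted_moment[OF rho, of "{0}" n "\<lambda>_. 0" "\<lambda>_. 0"] n
      by (simp add: X_def[abs_def] multi_index_def multi_fact_def)
    moreover have "(\<lambda>\<omega>. X \<omega> * X \<omega>) = X" by (auto simp: X_def fun_eq_iff)
    ultimately show ?thesis by (simp add: has_bochner_integral_iff)
  qed
  \<comment> \<open>The square is recentred at \<open>W\<close>: the terms
    \<open>2 * (F \<omega> * W \<omega>)\<close> and \<open>2 * (F \<omega> * X \<omega>)\<close>
    have equal means by \<open>FX\<close>, so all dependence on \<open>F\<close> sits in a
    nonnegative square.\<close>
  have "(\<integral>\<omega>. (F \<omega> - X \<omega>)\<^sup>2 \<partial>?M) =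
      (\<integral>\<omega>. (F \<omega> - W \<omega>) * (F \<omega> - W \<omega>) + X \<omega> * X \<omega> - W \<omega> * W \<omega> + 2 * (F \<omega> * W \<omega>) - 2 * (F \<omega> * X \<omega>) \<partial>?M)"
    by (rule Bochner_Integration.integral_cong) (auto simp: power2_eq_square algebra_simps)
  also have "\<dots> = (\<integral>\<omega>. (F \<omega> - W \<omega>) * (F \<omega> - W \<omega>) \<partial>?M) + \<rho> - (\<integral>\<omega>. W \<omega> * W \<omega> \<partial>?M)"
    using FX XX by (simp add: int fspan_diff F X W)
  finally have eq: "(\<integral>\<omega>. (F \<omega> - X \<omega>)\<^sup>2 \<partial>?M) = \<dots>" .
  have "0 \<le> (\<integral>\<omega>. (F \<omega> - W \<omega>) * (F \<omega> - W \<omega>) \<partial>?M)" by simp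
  then have "\<rho> - \<rho>\<^sup>2 / (1 - r\<^sup>2)\<^sup>2 \<le> (\<integral>\<omega>. (F \<omega> - X \<omega>)\<^sup>2 \<partial>?M)"
    using eq dual_square_moment_le[OF rho n lam r D le] unfolding W_def by linarith
  then have "ennreal (\<rho> - \<rho>\<^sup>2 / (1 - r\<^sup>2)\<^sup>2) \<le> ennreal (\<integral>\<omega>. (F \<omega> - X \<omega>)\<^sup>2 \<partial>?M)"
    by (rule ennreal_leI)
  also have "\<dots> = (\<integral>\<^sup>+\<omega>. ennreal ((F \<omega> - X \<omega>)\<^sup>2) \<partial>?M)"
    using int[OF fspan_diff[OF F X] fspan_diff[OF F X]]
    by (intro nn_integral_eq_integral[symmetric]) (auto simp: power2_eq_square)
  finally show "ennreal (\<rho> - \<rho>\<^sup>2 / (1 - r\<^sup>2)\<^sup>2) \<le>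
      (\<integral>\<^sup>+\<omega>. ennreal ((polyval n D c (Yobs lam \<omega>) - of_bool (fst \<omega> 0))\<^sup>2) \<partial>?M)"
    unfolding f(2) F_def X_def .
qed

section \<open>Majority amplification\<close>

definition monomial_basis :: "nat \<Rightarrow> nat \<Rightarrow> ((nat \<times> nat \<Rightarrow> real) \<Rightarrow> real) set" where
  "monomial_basis n D = (\<lambda>m Y. prod_mset (image_mset Y m)) ` monomials n D"

lemma finite_monomials: "finite (monomials n D)"
proof (rule finite_subset)
  show "monomials n D \<subseteq> mset ` {xs. set xs \<subseteq> {0..<n} \<times> {0..<n} \<and> length xs \<le> D}"
  proof
    fix m assume m: "m \<in> monomials n D"
    obtain xs where "m = mset xs" using ex_mset by metis
    then show "m \<in> mset ` {xs. set xs \<subseteq> {0..<n} \<times> {0..<n} \<and> length xs \<le> D}"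
      using m by (auto simp: monomials_def)
  qed
  show "finite (mset ` {xs. set xs \<subseteq> {0..<n} \<times> {0..<n} \<and> length xs \<le> D})"
    by (intro finite_imageI finite_lists_length_le) simp
qed

lemma fspan_polyval:
  assumes "f \<in> fspan (monomial_basis n D)"
  shows "\<exists>c. \<forall>Y. f Y = polyval n D c Y"
  using assms
proof induction
  case (base f)
  then obtain m where m: "m \<in> monomials n D" "f = (\<lambda>Y. prod_mset (image_mset Y m))"
    unfolding monomial_basis_def by blast
  have "(\<Sum>\<alpha>\<in>monomials n D. of_bool (\<alpha> = m) * prod_mset (image_mset Y \<alpha>)) = f Y" for Y
  proof -
    have "(\<Sum>\<alpha>\<in>monomials n D. of_bool (\<alpha> = m) * prod_mset (image_mset Y \<alpha>)) =
        (\<Sum>\<alpha>\<in>{m}. of_bool (\<alpha> = m) * prod_mset (image_mset Y \<alpha>))"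
      by (rule sum.mono_neutral_right[OF finite_monomials]) (use m in auto)
    then show ?thesis by (simp add: m)
  qed
  then show ?case unfolding polyval_def by metis
next
  case zero
  show ?case by (rule exI[of _ "\<lambda>_. 0"]) (simp add: polyval_def)
next
  case (add f g)
  then obtain c d where "\<And>Y. f Y = polyval n D c Y" "\<And>Y. g Y = polyval n D d Y" by blast
  then show ?case by (intro exI[of _ "\<lambda>m. c m + d m"]) (simp add: polyval_def distrib_right sum.distrib)
next
  case (scale f a)
  then obtain c where "\<And>Y. f Y = polyval n D c Y" by blast
  then show ?case by (intro exI[of _ "\<lambda>m. a * c m"]) (simp add: polyval_def sum_distrib_left mult.assoc)
qed

lemma monomial_span_mult:
  assumes f: "f \<in> fspan (monomial_basis n a)" and g: "g \<in> fspan (monomial_basis n b)"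
  shows "(\<lambda>Y. f Y * g Y) \<in> fspan (monomial_basis n (a + b))"
  using f
proof induction
  case (base f)
  from g show ?case
  proof induction
    case (base g)
    obtain m m' where m: "m \<in> monomials n a" "f = (\<lambda>Y. prod_mset (image_mset Y m))"
      "m' \<in> monomials n b" "g = (\<lambda>Y. prod_mset (image_mset Y m'))"
      using base \<open>f \<in> monomial_basis n a\<close> unfolding monomial_basis_def by blast
    have "m + m' \<in> monomials n (a + b)" using m by (auto simp: monomials_def)
    then have "(\<lambda>Y. prod_mset (image_mset Y (m + m'))) \<in> monomial_basis n (a + b)"
      unfolding monomial_basis_def by (rule imageI)
    then show ?case unfolding m(2,4) by (intro fspan.base) simp
  next
    case zero
    show ?case by (simp add: fspan.zero)
  next
    case (add g h)
    then show ?case using fspan.add[OF add.IH] by (simp add: distrib_left)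
  next
    case (scale g c)
    then show ?case using fspan.scale[OF scale.IH, of c] by (simp add: mult.left_commute)
  qed
next
  case zero
  show ?case by (simp add: fspan.zero)
next
  case (add f h)
  then show ?case using fspan.add[OF add.IH] by (simp add: distrib_right)
next
  case (scale f c)
  then show ?case using fspan.scale[OF scale.IH, of c] by (simp add: mult.assoc)
qed

lemma monomial_span_const: "(\<lambda>_. c) \<in> fspan (monomial_basis n d)"
proof -
  have "{#} \<in> monomials n d" by (simp add: monomials_def)
  then have "(\<lambda>Y. prod_mset (image_mset Y {#})) \<in> monomial_basis n d"
    unfolding monomial_basis_def by (rule imageI)
  from fspan.scale[OF fspan.base[OF this], of c] show ?thesis by simp
qed

lemma monomial_span_power:
  assumes "f \<in> fspan (monomial_basis n 1)"
  shows "(\<lambda>Y. f Y ^ k) \<in> fspan (monomial_basis n k)"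
proof (induction k)
  case 0
  show ?case using monomial_span_const[of 1] by simp
next
  case (Suc k)
  show ?case using monomial_span_mult[OF assms Suc] by simp
qed

lemma monomial_span_coord:
  assumes "p \<in> {0..<n} \<times> {0..<n}"
  shows "(\<lambda>Y. Y p) \<in> fspan (monomial_basis n 1)"
proof -
  have "{#p#} \<in> monomials n 1" using assms by (auto simp: monomials_def)
  then have "(\<lambda>Y. prod_mset (image_mset Y {#p#})) \<in> monomial_basis n 1"
    unfolding monomial_basis_def by (rule imageI)
  from fspan.base[OF this] show ?thesis by simp
qed

text \<open>Probability that a majority of \<open>2k+1\<close> independent coins of bias \<open>t\<close> shows heads: a
  polynomial that sharpens values near \<open>0\<close> and \<open>1\<close>.\<close>

definition majority :: "nat \<Rightarrow> real \<Rightarrow> real" where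
  "majority k t = (\<Sum>j\<in>{k<..2 * k + 1}. real ((2 * k + 1) choose j) * (t ^ j * (1 - t) ^ (2 * k + 1 - j)))"

text \<open>Exchanging heads and tails swaps majority and minority, the number of coins being odd.
  Errors near 1 thereby reduce to errors near 0.\<close>

lemma majority_reflect: "majority k (1 - t) = 1 - majority k t"
proof -
  let ?g = "\<lambda>j. real ((2 * k + 1) choose j) * (t ^ j * (1 - t) ^ (2 * k + 1 - j))"
  have "majority k (1 - t) = (\<Sum>j\<in>{..k}. ?g j)"
    unfolding majority_def
  proof (rule sum.reindex_bij_witness[of _ "\<lambda>j. 2 * k + 1 - j" "\<lambda>j. 2 * k + 1 - j"])
    fix j assume "j \<in> {k<..2 * k + 1}"
    then have j: "j \<le> 2 * k + 1" by simp
    then show "?g (2 * k + 1 - j) = real ((2 * k + 1) choose j) * ((1 - t) ^ j * (1 - (1 - t)) ^ (2 * k + 1 - j))"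
      using binomial_symmetric[OF j] by simp
  qed auto
  moreover have "(\<Sum>j\<in>{..k}. ?g j) + (\<Sum>j\<in>{k<..2 * k + 1}. ?g j) = (\<Sum>j\<in>{..2 * k + 1}. ?g j)"
  proof (rule sum.union_disjoint[symmetric, THEN trans])
    show "sum ?g ({..k} \<union> {k<..2 * k + 1}) = sum ?g {..2 * k + 1}" by (rule sum.cong) auto
  qed auto
  moreover have "(\<Sum>j\<in>{..2 * k + 1}. ?g j) = 1"
    using binomial_ring[of t "1 - t" "2 * k + 1"] by (simp add: mult.assoc)
  ultimately show ?thesis unfolding majority_def by linarith
qed

text \<open>Each term contains at least \<open>k + 1\<close> factors \<open>t\<close>; each of the
  other \<open>k\<close> factors is at most \<open>1 + |t|\<close> in absolute value, and the
  binomial coefficients add up to at most 2^(2k+1). The bound covers every real \<open>t\<close>, as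
  the statistic can leave [0,1].\<close>

lemma majority_bound: "\<bar>majority k t\<bar> \<le> 2 * 4 ^ k * \<bar>t\<bar> ^ (k + 1) * (1 + \<bar>t\<bar>) ^ k"
proof -
  have "\<bar>majority k t\<bar> \<le> (\<Sum>j\<in>{k<..2 * k + 1}. real ((2 * k + 1) choose j) * (\<bar>t\<bar> ^ (k + 1) * (1 + \<bar>t\<bar>) ^ k))"
    unfolding majority_def
  proof (rule order_trans[OF sum_abs sum_mono])
    fix j assume j: "j \<in> {k<..2 * k + 1}"
    have "\<bar>t\<bar> ^ j * \<bar>1 - t\<bar> ^ (2 * k + 1 - j) \<le> (\<bar>t\<bar> ^ (k + 1) * (1 + \<bar>t\<bar>) ^ (j - (k + 1))) * (1 + \<bar>t\<bar>) ^ (2 * k + 1 - j)"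
    proof (rule mult_mono)
      have "\<bar>t\<bar> ^ j = \<bar>t\<bar> ^ (k + 1) * \<bar>t\<bar> ^ (j - (k + 1))" using j by (subst power_add[symmetric]) simp
      also have "\<dots> \<le> \<bar>t\<bar> ^ (k + 1) * (1 + \<bar>t\<bar>) ^ (j - (k + 1))"
        by (intro mult_left_mono power_mono) auto
      finally show "\<bar>t\<bar> ^ j \<le> \<bar>t\<bar> ^ (k + 1) * (1 + \<bar>t\<bar>) ^ (j - (k + 1))" .
    qed (auto intro!: power_mono)
    also have "\<dots> = \<bar>t\<bar> ^ (k + 1) * (1 + \<bar>t\<bar>) ^ (j - (k + 1) + (2 * k + 1 - j))"
      by (simp add: power_add)
    also have "j - (k + 1) + (2 * k + 1 - j) = k" using j by auto
    finally show "\<bar>real ((2 * k + 1) choose j) * (t ^ j * (1 - t) ^ (2 * k + 1 - j))\<bar> \<le>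
        real ((2 * k + 1) choose j) * (\<bar>t\<bar> ^ (k + 1) * (1 + \<bar>t\<bar>) ^ k)"
      by (simp add: abs_mult power_abs mult_left_mono)
  qed
  also have "\<dots> = (\<Sum>j\<in>{k<..2 * k + 1}. real ((2 * k + 1) choose j)) * (\<bar>t\<bar> ^ (k + 1) * (1 + \<bar>t\<bar>) ^ k)"
    by (rule sum_distrib_right[symmetric])
  also have "\<dots> \<le> (2 * 4 ^ k) * (\<bar>t\<bar> ^ (k + 1) * (1 + \<bar>t\<bar>) ^ k)"
  proof (rule mult_right_mono)
    have "(\<Sum>j\<in>{k<..2 * k + 1}. real ((2 * k + 1) choose j)) \<le> (\<Sum>j\<le>2 * k + 1. real ((2 * k + 1) choose j))"
      by (rule sum_mono2) auto
    also have "\<dots> = real (2 ^ (2 * k + 1))"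
      unfolding of_nat_sum[symmetric] choose_row_sum ..
    also have "\<dots> = 2 * 4 ^ k" by (simp add: power_mult)
    finally show "(\<Sum>j\<in>{k<..2 * k + 1}. real ((2 * k + 1) choose j)) \<le> 2 * 4 ^ k" .
  qed simp
  finally show ?thesis by (simp add: mult.assoc)
qed

lemma majority_span:
  assumes "t \<in> fspan (monomial_basis n 1)"
  shows "(\<lambda>Y. majority k (t Y)) \<in> fspan (monomial_basis n (2 * k + 1))"
  unfolding majority_def
proof (intro fspan_sum fspan.scale)
  fix j assume j: "j \<in> {k<..2 * k + 1}"
  have "(\<lambda>Y. 1 - t Y) \<in> fspan (monomial_basis n 1)"
    by (rule fspan_diff[OF monomial_span_const assms])
  from monomial_span_mult[OF monomial_span_power[OF assms, of j] monomial_span_power[OF this, of "2 * k + 1 - j"]]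
  show "(\<lambda>Y. t Y ^ j * (1 - t Y) ^ (2 * k + 1 - j)) \<in> fspan (monomial_basis n (2 * k + 1))"
    using j by simp
qed

section \<open>From the majority error to exponential moments\<close>

text \<open>Measured in units of \<open>r\<close>, the k + 1 factors |T| release the power of
  \<open>r\<close>; what is left is a polynomial in \<open>x = |T| / r\<close>, dominated by one
  exponential.\<close>

lemma majority_error_bound:
  fixes T r :: real
  assumes r: "0 < r" "r < 1"
  shows "(2 * 4 ^ k * \<bar>T\<bar> ^ (k + 1) * (1 + \<bar>T\<bar>) ^ k)\<^sup>2
    \<le> r ^ (2 * k) * (exp (- (2 * real k + 2)) / 4 * exp ((10 * real k + 8) * (\<bar>T\<bar> / r)))"
proof -
  define x where "x = \<bar>T\<bar> / r"
  have x: "0 \<le> x" using r by (simp add: x_def)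
  have T: "\<bar>T\<bar> = r * x" using r by (simp add: x_def)
  have Tx: "\<bar>T\<bar> \<le> x" unfolding T using r x by (simp add: mult_left_le_one_le)
  \<comment> \<open>The shift by -1 in this tangent bound is what accumulates, after k + 1 uses and
    squaring, to the factor \<open>exp (- (2 * real k + 2))\<close>.\<close>
  have e1: "4 * x \<le> exp (4 * x - 1)" using exp_ge_add_one_self[of "4 * x - 1"] by simp
  have e2: "1 + x \<le> exp x" by (rule exp_ge_add_one_self)
  have e3: "4 * x * (1 + x) \<le> exp (5 * x - 1)"
  proof -
    have "4 * x * (1 + x) \<le> exp (4 * x - 1) * exp x" using e1 e2 x by (intro mult_mono) auto
    also have "\<dots> = exp (5 * x - 1)" by (simp flip: exp_add)
    finally show ?thesis .
  qed
  have "2 * 4 ^ k * \<bar>T\<bar> ^ (k + 1) * (1 + \<bar>T\<bar>) ^ k \<le> 2 * 4 ^ k * (r * x) ^ (k + 1) * (1 + x) ^ k"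
    unfolding T[symmetric] using Tx by (intro mult_left_mono power_mono) auto
  \<comment> \<open>Writing \<open>2 * 4 ^ k\<close> as half of \<open>4 ^ (k + 1)\<close> gives
    each of the k + 1 factors \<open>x\<close> its own 4.\<close>
  also have "\<dots> = 1/2 * r ^ (k + 1) * (4 * x) * (4 * x * (1 + x)) ^ k"
    by (simp add: power_mult_distrib)
  also have "\<dots> \<le> 1/2 * r ^ k * exp (4 * x - 1) * exp (5 * x - 1) ^ k"
    using e1 e3 x r by (intro mult_mono power_mono power_decreasing) auto
  finally have "(2 * 4 ^ k * \<bar>T\<bar> ^ (k + 1) * (1 + \<bar>T\<bar>) ^ k)\<^sup>2 \<le> (1/2 * r ^ k * exp (4 * x - 1) * exp (5 * x - 1) ^ k)\<^sup>2"
    by (rule power_mono) simp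
  also have "\<dots> = r ^ (2 * k) * (1/4 * (exp (4 * x - 1) * exp (real k * (5 * x - 1)))\<^sup>2)"
    by (simp add: power_mult_distrib power_even_eq exp_of_nat_mult power_divide)
  also have "(exp (4 * x - 1) * exp (real k * (5 * x - 1)))\<^sup>2 = exp (- (2 * real k + 2)) * exp ((10 * real k + 8) * x)"
    unfolding exp_add[symmetric] exp_double[symmetric] by (simp add: algebra_simps)
  finally show ?thesis by (simp add: x_def)
qed

text \<open>The point \<open>s\<close> is the exponent delivered by
  \<open>majority_error_bound\<close>, and exp(s|T|) is at most the sum of the two signed
  exponentials. The budget \<open>2 * exp (2 * real k + 2)\<close> for each sign cancels the
  constant \<open>exp (- (2 * real k + 2)) / 4\<close> exactly.\<close>

lemma MMSE_upper_bound_mgf: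
  assumes t: "t \<in> fspan (monomial_basis n 1)" and r: "0 < r" "r < 1"
    and s: "s = (10 * real k + 8) / r"
    and pos: "integrable (planted_space n \<rho>) (\<lambda>\<omega>. exp (s * (t (Yobs lam \<omega>) - of_bool (fst \<omega> 0))))"
    and neg: "integrable (planted_space n \<rho>) (\<lambda>\<omega>. exp (- s * (t (Yobs lam \<omega>) - of_bool (fst \<omega> 0))))"
    and B: "(\<integral>\<omega>. exp (s * (t (Yobs lam \<omega>) - of_bool (fst \<omega> 0))) \<partial>planted_space n \<rho>) \<le> 2 * exp (2 * real k + 2)"
      "(\<integral>\<omega>. exp (- s * (t (Yobs lam \<omega>) - of_bool (fst \<omega> 0))) \<partial>planted_space n \<rho>) \<le> 2 * exp (2 * real k + 2)"
  shows "MMSE n lam \<rho> (2 * k + 1) \<le> ennreal (r ^ (2 * k))"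
proof -
  let ?M = "planted_space n \<rho>"
  define T where "T \<omega> = t (Yobs lam \<omega>) - of_bool (fst \<omega> 0)" for \<omega>
  define C where "C = r ^ (2 * k) * (exp (- (2 * real k + 2)) / 4)"
  obtain c where c: "\<And>Y. majority k (t Y) = polyval n (2 * k + 1) c Y"
    using fspan_polyval[OF majority_span[OF t]] by blast
  have C: "0 \<le> C" using r by (simp add: C_def)
  have err: "(majority k (t (Yobs lam \<omega>)) - of_bool (fst \<omega> 0))\<^sup>2 \<le> C * (exp (s * T \<omega>) + exp (- s * T \<omega>))" for \<omega>
  proof -
    have "\<bar>majority k (t (Yobs lam \<omega>)) - of_bool (fst \<omega> 0)\<bar> \<le> 2 * 4 ^ k * \<bar>T \<omega>\<bar> ^ (k + 1) * (1 + \<bar>T \<omega>\<bar>) ^ k"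
    proof (cases "fst \<omega> 0")
      case True
      then have "majority k (t (Yobs lam \<omega>)) - of_bool (fst \<omega> 0) = - majority k (- T \<omega>)"
        using majority_reflect[of k "t (Yobs lam \<omega>)"] by (simp add: T_def)
      then show ?thesis using majority_bound[of k "- T \<omega>"] by simp
    next
      case False
      then show ?thesis using majority_bound[of k "T \<omega>"] by (simp add: T_def)
    qed
    then have "(majority k (t (Yobs lam \<omega>)) - of_bool (fst \<omega> 0))\<^sup>2 \<le> (2 * 4 ^ k * \<bar>T \<omega>\<bar> ^ (k + 1) * (1 + \<bar>T \<omega>\<bar>) ^ k)\<^sup>2"
      by (intro abs_le_square_iff[THEN iffD1]) simp
    also have "\<dots> \<le> C * exp (s * \<bar>T \<omega>\<bar>)"
      using majority_error_bound[OF r, of k "T \<omega>"] by (simp add: C_def s mult.assoc)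
    also have "\<dots> \<le> C * (exp (s * T \<omega>) + exp (- s * T \<omega>))"
      using C by (intro mult_left_mono) (auto simp: abs_if)
    finally show ?thesis .
  qed
  have int: "integrable ?M (\<lambda>\<omega>. C * (exp (s * T \<omega>) + exp (- s * T \<omega>)))"
    using pos neg unfolding T_def by (intro integrable_mult_right Bochner_Integration.integrable_add)
  have "MMSE n lam \<rho> (2 * k + 1) \<le> (\<integral>\<^sup>+ \<omega>. ennreal ((polyval n (2 * k + 1) c (Yobs lam \<omega>) - of_bool (fst \<omega> 0))\<^sup>2) \<partial>?M)"
    unfolding MMSE_def by (rule INF_lower) simp
  also have "\<dots> \<le> (\<integral>\<^sup>+ \<omega>. ennreal (C * (exp (s * T \<omega>) + exp (- s * T \<omega>))) \<partial>?M)"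
    unfolding c[symmetric] by (intro nn_integral_mono ennreal_leI err)
  also have "\<dots> = ennreal (\<integral>\<omega>. C * (exp (s * T \<omega>) + exp (- s * T \<omega>)) \<partial>?M)"
    by (rule nn_integral_eq_integral[OF int]) (use C in auto)
  also have "\<dots> \<le> ennreal (r ^ (2 * k))"
  proof (rule ennreal_leI)
    have "(\<integral>\<omega>. C * (exp (s * T \<omega>) + exp (- s * T \<omega>)) \<partial>?M) =
        C * ((\<integral>\<omega>. exp (s * T \<omega>) \<partial>?M) + (\<integral>\<omega>. exp (- s * T \<omega>) \<partial>?M))"
      using pos neg unfolding T_def by simp
    also have "\<dots> \<le> C * (4 * exp (2 * real k + 2))"
      using B C unfolding T_def by (intro mult_left_mono) auto
    also have "\<dots> = r ^ (2 * k) * (exp (- (2 * real k + 2)) * exp (2 * real k + 2))" by (simp add: C_def)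
    also have "\<dots> = r ^ (2 * k)" unfolding exp_add[symmetric] by simp
    finally show "(\<integral>\<omega>. C * (exp (s * T \<omega>) + exp (- s * T \<omega>)) \<partial>?M) \<le> r ^ (2 * k)" .
  qed
  finally show ?thesis .
qed

section \<open>Moment generating functions of the noise, the planted vector and the row
  statistic\<close>

lemma gaussian_mgf:
  assumes "0 < \<sigma>"
  shows "has_bochner_integral (gaussian \<sigma>) (\<lambda>z. exp (b * z)) (exp ((b * \<sigma>)\<^sup>2 / 2))"
proof -
  \<comment> \<open>Completing the square: exponential tilting moves the mean of the normal density
    by b \<sigma>^2.\<close>
  have eq: "normal_density 0 \<sigma> z * exp (b * z) = exp ((b * \<sigma>)\<^sup>2 / 2) * normal_density (b * \<sigma>\<^sup>2) \<sigma> z" for z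
  proof -
    have "- (z - 0)\<^sup>2 / (2 * \<sigma>\<^sup>2) + b * z = (b * \<sigma>)\<^sup>2 / 2 + - (z - b * \<sigma>\<^sup>2)\<^sup>2 / (2 * \<sigma>\<^sup>2)"
      using assms by (simp add: field_simps power2_eq_square)
    then have "exp (- (z - 0)\<^sup>2 / (2 * \<sigma>\<^sup>2)) * exp (b * z) = exp ((b * \<sigma>)\<^sup>2 / 2) * exp (- (z - b * \<sigma>\<^sup>2)\<^sup>2 / (2 * \<sigma>\<^sup>2))"
      unfolding exp_add[symmetric] by simp
    then show ?thesis unfolding normal_density_def by (simp add: mult_ac)
  qed
  have int: "integrable lborel (normal_density (b * \<sigma>\<^sup>2) \<sigma>)"
    using integrable_normal_moment[OF assms, of "b * \<sigma>\<^sup>2" 0] by simp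
  have "integrable (gaussian \<sigma>) (\<lambda>z. exp (b * z))"
    using int by (subst integrable_density) (auto simp: normal_density_nonneg eq)
  moreover have "(\<integral>z. exp (b * z) \<partial>gaussian \<sigma>) = exp ((b * \<sigma>)\<^sup>2 / 2)"
    using integral_normal_density[OF assms, of "b * \<sigma>\<^sup>2"]
    by (subst integral_density) (auto simp: normal_density_nonneg eq)
  ultimately show ?thesis by (simp add: has_bochner_integral_iff)
qed

lemma v_law_mgf:
  assumes rho: "0 < \<rho>" "\<rho> < 1"
  shows "has_bochner_integral (v_law n \<rho>) (\<lambda>v. exp (\<Sum>i\<in>{0..<n}. a i * of_bool (v i)))
    (\<Prod>i\<in>{0..<n}. 1 - \<rho> + \<rho> * exp (a i))"
proof -
  interpret product_prob_space "\<lambda>_::nat. measure_pmf (bernoulli_pmf \<rho>)" "{0..<n}"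
    by unfold_locales
  define f where "f i b = exp (a i * of_bool b)" for i :: nat and b
  have int: "integrable (measure_pmf (bernoulli_pmf \<rho>)) (f i)" for i
    by (rule integrable_measure_pmf_finite) (simp add: finite_subset[OF subset_UNIV])
  have val: "(\<integral>b. f i b \<partial>bernoulli_pmf \<rho>) = 1 - \<rho> + \<rho> * exp (a i)" for i
    using rho by (simp add: f_def)
  have eq: "(\<Prod>i\<in>{0..<n}. f i (v i)) = exp (\<Sum>i\<in>{0..<n}. a i * of_bool (v i))" for v
    by (simp only: f_def exp_sum[OF finite_atLeastLessThan])
  have "integrable (v_law n \<rho>) (\<lambda>v. \<Prod>i\<in>{0..<n}. f i (v i))"
    unfolding v_law_def by (rule product_integrable_prod) (use int in auto)
  moreover have "(\<integral>v. (\<Prod>i\<in>{0..<n}. f i (v i)) \<partial>v_law n \<rho>) = (\<Prod>i\<in>{0..<n}. \<integral>b. f i b \<partial>bernoulli_pmf \<rho>)"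
    unfolding v_law_def by (rule product_integral_prod) (use int in auto)
  ultimately show ?thesis by (simp add: has_bochner_integral_iff eq val)
qed

lemma W_law_mgf:
  "has_bochner_integral (W_law n) (\<lambda>z. exp (\<Sum>e\<in>upper_pairs n. b e * z e))
    (exp (\<Sum>e\<in>upper_pairs n. (b e * sd e)\<^sup>2 / 2))"
proof -
  interpret product_sigma_finite "\<lambda>e. gaussian (sd e)"
    by (rule product_sigma_finite.intro)
      (rule prob_space_imp_sigma_finite[OF prob_space_normal_density[OF sd_pos]])
  note mgf = gaussian_mgf[OF sd_pos, THEN has_bochner_integral_iff[THEN iffD1]]
  have "integrable (W_law n) (\<lambda>z. \<Prod>e\<in>upper_pairs n. exp (b e * z e))"
    unfolding W_law_eq by (rule product_integrable_prod[OF finite_upper_pairs]) (use mgf in blast)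
  moreover have "(\<integral>z. (\<Prod>e\<in>upper_pairs n. exp (b e * z e)) \<partial>W_law n) =
      (\<Prod>e\<in>upper_pairs n. \<integral>z. exp (b e * z) \<partial>gaussian (sd e))"
    unfolding W_law_eq by (rule product_integral_prod[OF finite_upper_pairs]) (use mgf in blast)
  ultimately show ?thesis
    using mgf by (simp add: has_bochner_integral_iff exp_sum finite_upper_pairs)
qed

lemma planted_mgf:
  assumes rho: "0 < \<rho>" "\<rho> < 1"
  shows "has_bochner_integral (planted_space n \<rho>)
    (\<lambda>\<omega>. exp (\<Sum>i\<in>{0..<n}. a i * of_bool (fst \<omega> i)) * exp (\<Sum>e\<in>upper_pairs n. b e * snd \<omega> e))
    ((\<Prod>i\<in>{0..<n}. 1 - \<rho> + \<rho> * exp (a i)) * exp (\<Sum>e\<in>upper_pairs n. (b e * sd e)\<^sup>2 / 2))"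
  unfolding planted_space_def
  by (rule has_bochner_integral_pair_mult[OF prob_space_v_law prob_space_W_law v_law_mgf[OF rho] W_law_mgf])

text \<open>The exponent is c^2 and not c^2/2 because diagonal noise has variance 2.\<close>

lemma planted_mgf_diagonal:
  assumes rho: "0 < \<rho>" "\<rho> < 1" and n: "n \<ge> 1"
  shows "has_bochner_integral (planted_space n \<rho>) (\<lambda>\<omega>. exp (c * snd \<omega> (0, 0))) (exp (c\<^sup>2))"
proof -
  have E: "(0, 0) \<in> upper_pairs n" using n by (simp add: upper_pairs_def)
  let ?b = "\<lambda>e. c * of_bool (e = (0, 0))"
  have sum: "(\<Sum>e\<in>upper_pairs n. ?b e * g e) = c * g (0, 0)" for g :: "nat \<times> nat \<Rightarrow> real"
  proof -
    have "(\<Sum>e\<in>upper_pairs n. ?b e * g e) = (\<Sum>e\<in>{(0, 0)}. ?b e * g e)"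
      by (rule sum.mono_neutral_right[OF finite_upper_pairs]) (use E in auto)
    then show ?thesis by simp
  qed
  have "(\<Sum>e\<in>upper_pairs n. (?b e * sd e)\<^sup>2 / 2) = (\<Sum>e\<in>{(0, 0)}. (?b e * sd e)\<^sup>2 / 2)"
    by (rule sum.mono_neutral_right[OF finite_upper_pairs]) (use E in auto)
  also have "\<dots> = c\<^sup>2" by (simp add: sd_def power_mult_distrib)
  finally show ?thesis using planted_mgf[OF rho, of n "\<lambda>_. 0" ?b] by (simp add: sum)
qed

text \<open>The row starts at \<open>j = 1\<close>: leaving out the diagonal entry keeps all noise
  variances equal to 1 and makes the count of ones independent of the target.\<close>

lemma planted_mgf_row:
  assumes rho: "0 < \<rho>" "\<rho> < 1"
  shows "has_bochner_integral (planted_space n \<rho>)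
    (\<lambda>\<omega>. exp (u * (\<Sum>j\<in>{1..<n}. of_bool (fst \<omega> j))) * exp (c * (\<Sum>j\<in>{1..<n}. snd \<omega> (0, j))))
    ((1 - \<rho> + \<rho> * exp u) ^ (n - 1) * exp (real (n - 1) * (c\<^sup>2 / 2)))"
proof -
  let ?a = "\<lambda>i::nat. u * of_bool (i \<noteq> 0)" and ?b = "\<lambda>e. c * of_bool (e \<in> Pair (0::nat) ` {1..<n})"
  have sub: "Pair 0 ` {1..<n} \<subseteq> upper_pairs n" by (auto simp: upper_pairs_def)
  have inj: "inj_on (Pair (0::nat)) {1..<n}" by (auto simp: inj_on_def)
  have row: "(\<Sum>e\<in>upper_pairs n. of_bool (e \<in> Pair 0 ` {1..<n}) * g e) = (\<Sum>j\<in>{1..<n}. g (0, j))" for g :: "nat \<times> nat \<Rightarrow> real"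
  proof -
    have "(\<Sum>e\<in>upper_pairs n. of_bool (e \<in> Pair 0 ` {1..<n}) * g e) =
        (\<Sum>e\<in>Pair 0 ` {1..<n}. of_bool (e \<in> Pair 0 ` {1..<n}) * g e)"
      by (rule sum.mono_neutral_right[OF finite_upper_pairs sub]) auto
    also have "\<dots> = (\<Sum>e\<in>Pair 0 ` {1..<n}. g e)" by (rule sum.cong) auto
    also have "\<dots> = (\<Sum>j\<in>{1..<n}. g (0, j))" unfolding sum.reindex[OF inj] o_def ..
    finally show ?thesis .
  qed
  have s1: "(\<Sum>i\<in>{0..<n}. ?a i * of_bool (v i)) = u * (\<Sum>j\<in>{1..<n}. of_bool (v j))" for v :: "nat \<Rightarrow> bool"
    unfolding sum_distrib_left by (rule sum.mono_neutral_cong_right) auto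
  have s2: "(\<Sum>e\<in>upper_pairs n. ?b e * z e) = c * (\<Sum>j\<in>{1..<n}. z (0, j))" for z :: "nat \<times> nat \<Rightarrow> real"
    unfolding row[symmetric] sum_distrib_left by (simp add: mult.assoc)
  have s3: "(\<Sum>e\<in>upper_pairs n. (?b e * sd e)\<^sup>2 / 2) = real (n - 1) * (c\<^sup>2 / 2)"
  proof -
    have "(\<Sum>e\<in>upper_pairs n. (?b e * sd e)\<^sup>2 / 2) =
        (\<Sum>e\<in>upper_pairs n. of_bool (e \<in> Pair 0 ` {1..<n}) * ((c * sd e)\<^sup>2 / 2))"
      by (rule sum.cong) auto
    also have "\<dots> = (\<Sum>j\<in>{1..<n}. (c * sd (0, j))\<^sup>2 / 2)" by (rule row)
    also have "\<dots> = (\<Sum>j\<in>{1..<n}. c\<^sup>2 / 2)" by (rule sum.cong) (auto simp: sd_def)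
    finally show ?thesis by simp
  qed
  have s4: "(\<Prod>i\<in>{0..<n}. 1 - \<rho> + \<rho> * exp (?a i)) = (1 - \<rho> + \<rho> * exp u) ^ (n - 1)"
  proof -
    have "(\<Prod>i\<in>{0..<n}. 1 - \<rho> + \<rho> * exp (?a i)) = (\<Prod>i\<in>{1..<n}. 1 - \<rho> + \<rho> * exp u)"
      by (rule prod.mono_neutral_cong_right) auto
    then show ?thesis by simp
  qed
  show ?thesis using planted_mgf[OF rho, of n ?a ?b] unfolding s1 s2 s3 s4 .
qed

lemma exp_le_quadratic:
  fixes u :: real
  assumes "\<bar>u\<bar> \<le> 1"
  shows "exp u \<le> 1 + u + u\<^sup>2"
proof (cases "0 \<le> u")
  case True
  then show ?thesis using assms by (intro exp_bound) auto
next
  case False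
  define x where "x = - u"
  have x: "0 < x" using False by (simp add: x_def)
  have "exp u = 1 / exp x" by (simp add: x_def exp_minus field_simps)
  also have "\<dots> \<le> 1 / (1 + x)" using x by (intro divide_left_mono exp_ge_add_one_self) auto
  also have "\<dots> \<le> 1 - x + x\<^sup>2"
  proof -
    have "(1 - x + x\<^sup>2) * (1 + x) = 1 + x ^ 3" by (simp add: algebra_simps power2_eq_square power3_eq_cube)
    then have "1 \<le> (1 - x + x\<^sup>2) * (1 + x)" using x by simp
    then show ?thesis using x by (simp add: pos_divide_le_eq)
  qed
  finally show ?thesis by (simp add: x_def)
qed

text \<open>The quadratic bound on exp is averaged over one Bernoulli variable and re-exponentiated
  by 1 + y \<le> exp y; centring then removes the linear term.\<close>

lemma bernoulli_centered_mgf: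
  assumes rho: "0 < \<rho>" "\<rho> < 1" and u: "\<bar>u\<bar> \<le> 1"
  shows "exp (- (\<rho> * real m * u)) * (1 - \<rho> + \<rho> * exp u) ^ m \<le> exp (\<rho> * real m * u\<^sup>2)"
proof -
  have "1 - \<rho> + \<rho> * exp u \<le> 1 + \<rho> * (u + u\<^sup>2)"
    using mult_left_mono[OF exp_le_quadratic[OF u], of \<rho>] rho by (simp add: algebra_simps)
  also have "\<dots> \<le> exp (\<rho> * (u + u\<^sup>2))" by (rule exp_ge_add_one_self)
  finally have "(1 - \<rho> + \<rho> * exp u) ^ m \<le> exp (\<rho> * (u + u\<^sup>2)) ^ m"
    using rho by (intro power_mono) auto
  also have "\<dots> = exp (real m * (\<rho> * (u + u\<^sup>2)))" by (simp add: exp_of_nat_mult)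
  finally have "exp (- (\<rho> * real m * u)) * (1 - \<rho> + \<rho> * exp u) ^ m \<le>
      exp (- (\<rho> * real m * u)) * exp (real m * (\<rho> * (u + u\<^sup>2)))" by simp
  also have "\<dots> = exp (\<rho> * real m * u\<^sup>2)" unfolding exp_add[symmetric] by (simp add: algebra_simps)
  finally show ?thesis .
qed

text \<open>In place of conditioning on the target, the exponential is dominated by the sum of its
  two possible forms, which is the source of the factor 2. The condition on \<open>c\<close> keeps
  the tilt \<open>w\<close> within the range of the quadratic bound. In the exponent, the first term
  is the fluctuation of the count of ones, the second the Gaussian noise.\<close>

lemma row_statistic_mgf:
  assumes rho: "0 < \<rho>" "\<rho> < 1" and n: "n \<ge> 2" and lam: "0 < lam"
    and u: "\<bar>c\<bar> \<le> \<rho> * real (n - 1)"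
  defines "T \<equiv> \<lambda>\<omega>. (\<Sum>j\<in>{1..<n}. 1 / (lam * \<rho> * real (n - 1)) * Yobs lam \<omega> (0, j)) - of_bool (fst \<omega> 0)"
  shows "integrable (planted_space n \<rho>) (\<lambda>\<omega>. exp (c * T \<omega>))"
    and "(\<integral>\<omega>. exp (c * T \<omega>) \<partial>planted_space n \<rho>) \<le>
      2 * exp (c\<^sup>2 / (\<rho> * real (n - 1)) + c\<^sup>2 / (2 * (lam\<^sup>2 * \<rho>\<^sup>2 * real (n - 1))))"
proof -
  let ?M = "planted_space n \<rho>"
  define m where "m = real (n - 1)"
  have m: "0 < m" using n by (simp add: m_def)
  define b where "b = c / (lam * \<rho> * m)"
  define w where "w = c / (\<rho> * m)"
  define S where "S \<omega> = (\<Sum>j\<in>{1..<n}. of_bool (fst \<omega> j) :: real)" for \<omega> :: "(nat \<Rightarrow> bool) \<times> (nat \<times> nat \<Rightarrow> real)"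
  define Z where "Z \<omega> = (\<Sum>j\<in>{1..<n}. snd \<omega> (0, j))" for \<omega> :: "(nat \<Rightarrow> bool) \<times> (nat \<times> nat \<Rightarrow> real)"
  \<comment> \<open>If the target is 0 only noise remains; if it is 1 the count of ones enters, and
    \<open>c\<close> is exactly the mean of \<open>w * S\<close>.\<close>
  have T: "c * T \<omega> = of_bool (fst \<omega> 0) * (w * S \<omega> - c) + b * Z \<omega>" for \<omega>
  proof -
    have "(\<Sum>j\<in>{1..<n}. 1 / (lam * \<rho> * m) * Yobs lam \<omega> (0, j)) =
        1 / (lam * \<rho> * m) * (lam * of_bool (fst \<omega> 0) * S \<omega> + Z \<omega>)"
      unfolding S_def Z_def sum_distrib_left sum.distrib[symmetric] by (simp add: Yobs_def)
    then have "c * T \<omega> = c * (1 / (lam * \<rho> * m) * (lam * of_bool (fst \<omega> 0) * S \<omega> + Z \<omega>) - of_bool (fst \<omega> 0))"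
      by (simp add: T_def m_def)
    also have "\<dots> = of_bool (fst \<omega> 0) * (w * S \<omega> - c) + b * Z \<omega>"
      using lam rho m by (simp add: w_def b_def field_simps)
    finally show ?thesis .
  qed
  have I0: "has_bochner_integral ?M (\<lambda>\<omega>. exp (b * Z \<omega>)) (exp (m * (b\<^sup>2 / 2)))"
    using planted_mgf_row[OF rho, of n 0 b] by (simp add: Z_def[abs_def] m_def)
  have I1: "has_bochner_integral ?M (\<lambda>\<omega>. exp (w * S \<omega>) * exp (b * Z \<omega>))
      ((1 - \<rho> + \<rho> * exp w) ^ (n - 1) * exp (m * (b\<^sup>2 / 2)))"
    using planted_mgf_row[OF rho, of n w b] by (simp add: S_def[abs_def] Z_def[abs_def] m_def)
  define G where "G \<omega> = exp (b * Z \<omega>) + exp (- c) * (exp (w * S \<omega>) * exp (b * Z \<omega>))" for \<omega>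
  have G: "has_bochner_integral ?M G (exp (m * (b\<^sup>2 / 2)) + exp (- c) * ((1 - \<rho> + \<rho> * exp w) ^ (n - 1) * exp (m * (b\<^sup>2 / 2))))"
    unfolding G_def by (intro has_bochner_integral_add has_bochner_integral_mult_right I0 I1)
  have le: "exp (c * T \<omega>) \<le> G \<omega>" for \<omega>
    unfolding T G_def by (cases "fst \<omega> 0") (auto simp: exp_add exp_diff exp_minus field_simps)
  have meas: "(\<lambda>\<omega>. exp (c * T \<omega>)) \<in> borel_measurable ?M"
  proof -
    have v [measurable]: "(\<lambda>\<omega>. fst \<omega> j) \<in> measurable ?M (count_space UNIV)" if "j < n" for j
    proof -
      have "(\<lambda>v. v j) \<in> measurable (v_law n \<rho>) (measure_pmf (bernoulli_pmf \<rho>))"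
        unfolding v_law_def by (rule measurable_component_singleton) (use that in simp)
      then have "(\<lambda>v. v j) \<in> measurable (v_law n \<rho>) (count_space UNIV)"
        by (simp cong: measurable_cong_sets)
      from measurable_compose[OF measurable_fst this] show ?thesis unfolding planted_space_def .
    qed
    have [measurable]: "(\<lambda>\<omega>. snd \<omega> (0, j)) \<in> borel_measurable ?M" if "j < n" for j
    proof -
      have "(\<lambda>z. z (0, j)) \<in> measurable (W_law n) (gaussian (sd (0, j)))"
        unfolding W_law_eq by (rule measurable_component_singleton) (use that in \<open>simp add: upper_pairs_def\<close>)
      then have "(\<lambda>z. z (0, j)) \<in> borel_measurable (W_law n)" by (simp cong: measurable_cong_sets)
      from measurable_compose[OF measurable_snd this] show ?thesis unfolding planted_space_def .
    qed
    have "S \<in> borel_measurable ?M" "Z \<in> borel_measurable ?M"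
      unfolding S_def[abs_def] Z_def[abs_def] by (intro borel_measurable_sum; measurable; simp)+
    moreover have "(\<lambda>\<omega>. of_bool (fst \<omega> 0) :: real) \<in> borel_measurable ?M"
      by (rule measurable_compose[OF v]) (use n in auto)
    ultimately show ?thesis unfolding T by measurable
  qed
  show int: "integrable ?M (\<lambda>\<omega>. exp (c * T \<omega>))"
    by (rule Bochner_Integration.integrable_bound[of _ G])
      (use G meas le in \<open>auto simp: has_bochner_integral_iff G_def intro!: AE_I2 order_trans[OF le] \<close>)
  have "(\<integral>\<omega>. exp (c * T \<omega>) \<partial>?M) \<le> (\<integral>\<omega>. G \<omega> \<partial>?M)"
    by (rule integral_mono[OF int]) (use G le in \<open>auto simp: has_bochner_integral_iff\<close>)
  also have "\<dots> = (1 + exp (- c) * (1 - \<rho> + \<rho> * exp w) ^ (n - 1)) * exp (m * (b\<^sup>2 / 2))"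
    using G by (simp add: has_bochner_integral_iff algebra_simps)
  also have "\<dots> \<le> (2 * exp (c\<^sup>2 / (\<rho> * m))) * exp (m * (b\<^sup>2 / 2))"
  proof (rule mult_right_mono)
    have w1: "\<bar>w\<bar> \<le> 1" using u rho m by (simp add: w_def m_def field_simps)
    have "\<rho> * m * w = c" "\<rho> * m * w\<^sup>2 = c\<^sup>2 / (\<rho> * m)"
      using rho m by (simp_all add: w_def power2_eq_square)
    then have "exp (- c) * (1 - \<rho> + \<rho> * exp w) ^ (n - 1) \<le> exp (c\<^sup>2 / (\<rho> * m))"
      using bernoulli_centered_mgf[OF rho w1, of "n - 1"] unfolding m_def[symmetric] by simp
    moreover have "1 \<le> exp (c\<^sup>2 / (\<rho> * m))" using rho m by simp
    ultimately show "1 + exp (- c) * (1 - \<rho> + \<rho> * exp w) ^ (n - 1) \<le> 2 * exp (c\<^sup>2 / (\<rho> * m))" by linarith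
  qed simp
  also have "\<dots> = 2 * exp (c\<^sup>2 / (\<rho> * m) + c\<^sup>2 / (2 * (lam\<^sup>2 * \<rho>\<^sup>2 * m)))"
    using m by (simp add: exp_add b_def power2_eq_square)
  finally show "(\<integral>\<omega>. exp (c * T \<omega>) \<partial>?M) \<le> 2 * exp (c\<^sup>2 / (\<rho> * real (n - 1)) + c\<^sup>2 / (2 * (lam\<^sup>2 * \<rho>\<^sup>2 * real (n - 1))))"
    by (simp add: m_def)
qed

section \<open>Choice of the statistic and of the constants\<close>

text \<open>A 0/1 variable equals its square, so \<open>Y (0, 0) / lam\<close> is the target plus
  Gaussian noise, and the error of the statistic is the noise alone.\<close>

lemma MMSE_upper_bound_diagonal:
  fixes \<rho> r lam L :: real
  assumes rho: "0 < \<rho>" "\<rho> < 1" and n: "n \<ge> 1" and r: "0 < r" "r < 1"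
    and L: "2 * (real k + 1) \<le> L" and lam: "24 / r * sqrt L \<le> lam"
  shows "MMSE n lam \<rho> (2 * k + 1) \<le> ennreal (r ^ (2 * k))"
proof -
  define s where "s = (10 * real k + 8) / r"
  have L0: "0 < L" by (rule less_le_trans[OF _ L]) simp
  have "0 < 24 / r * sqrt L" using r L0 by simp
  then have lam0: "0 < lam" using lam by linarith
  let ?t = "\<lambda>Y :: nat \<times> nat \<Rightarrow> real. 1 / lam * Y (0, 0)"
  have T: "?t (Yobs lam \<omega>) - of_bool (fst \<omega> 0) = snd \<omega> (0, 0) / lam" for \<omega>
    using lam0 by (simp add: Yobs_def field_simps)
  have mgf: "has_bochner_integral (planted_space n \<rho>)
      (\<lambda>\<omega>. exp (c * (?t (Yobs lam \<omega>) - of_bool (fst \<omega> 0)))) (exp ((c / lam)\<^sup>2))" for c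
    using planted_mgf_diagonal[OF rho n, of "c / lam"] unfolding T by simp
  have "(s / lam)\<^sup>2 \<le> 2 * real k + 2"
  proof -
    have "24 * sqrt L \<le> r * lam" using lam r by (simp add: field_simps)
    then have "(24 * sqrt L)\<^sup>2 \<le> (r * lam)\<^sup>2" using L0 by (intro power_mono) auto
    then have 1: "576 * L \<le> (r * lam)\<^sup>2" using L0 by (simp add: power_mult_distrib)
    \<comment> \<open>The 24 of the signal condition enters as 24^2 = 576. One factor
      \<open>k + 1\<close> is absorbed by \<open>L\<close>, the other by the budget
      \<open>2 * real k + 2\<close>.\<close>
    have "(10 * real k + 8)\<^sup>2 \<le> (10 * (real k + 1))\<^sup>2" by (intro power_mono) auto
    also have "\<dots> = 100 * (real k + 1) * (real k + 1)" by (simp only: power2_eq_square)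
    also have "\<dots> \<le> 576 * L * (2 * real k + 2)" using L by (intro mult_mono) auto
    also have "\<dots> \<le> (r * lam)\<^sup>2 * (2 * real k + 2)" using 1 by (intro mult_right_mono) auto
    finally have "(10 * real k + 8)\<^sup>2 / (r * lam)\<^sup>2 \<le> 2 * real k + 2"
      using r lam0 by (simp add: pos_divide_le_eq mult.commute)
    then show ?thesis unfolding s_def by (simp add: power_divide)
  qed
  then have "exp ((s / lam)\<^sup>2) \<le> exp (2 * real k + 2)" by simp
  also have "\<dots> \<le> 2 * exp (2 * real k + 2)" by simp
  finally have B: "exp ((s / lam)\<^sup>2) \<le> 2 * exp (2 * real k + 2)" .
  show ?thesis
  proof (rule MMSE_upper_bound_mgf[OF _ r s_def, where t = ?t])
    show "?t \<in> fspan (monomial_basis n 1)"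
      by (intro fspan.scale monomial_span_coord) (use n in auto)
  qed (use mgf[of s] mgf[of "- s"] B in \<open>auto simp: has_bochner_integral_iff\<close>)
qed

text \<open>The budget \<open>2 * real k + 2\<close> in the exponent is split evenly:
  \<open>k + 1\<close> for the fluctuation of the number of ones, controlled by the size condition,
  and \<open>k + 1\<close> for the averaged noise, controlled by the signal condition.\<close>

lemma MMSE_upper_bound_row:
  fixes \<rho> r lam L :: real
  assumes rho: "0 < \<rho>" "\<rho> < 1" and r: "0 < r" "r < 1"
    and L: "2 * (real k + 1) \<le> L"
    and lam: "24 / r * sqrt L \<le> lam * (\<rho> * sqrt (real n))"
    and size: "324 * L / r\<^sup>2 \<le> \<rho> * real n"
  shows "MMSE n lam \<rho> (2 * k + 1) \<le> ennreal (r ^ (2 * k))"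
proof -
  define s where "s = (10 * real k + 8) / r"
  have L0: "0 < L" by (rule less_le_trans[OF _ L]) simp
  have r2: "0 < r\<^sup>2" "r\<^sup>2 < 1" using r by (auto simp: power_less_one_iff)
  have Lr: "L \<le> L / r\<^sup>2" using L0 r2 by (simp add: pos_le_divide_eq mult_left_le)
  have "2 \<le> \<rho> * real n" using size Lr L by simp
  also have "\<dots> \<le> 1 * real n" using rho by (intro mult_right_mono) auto
  finally have n: "n \<ge> 2" by simp
  \<comment> \<open>The row without its diagonal entry has \<open>m\<close> terms. Passing from
    \<open>n\<close> to \<open>m\<close> costs a factor 2, which turns 324 into 162 and 24^2 = 576
    into 288.\<close>
  define m where "m = real (n - 1)"
  have m: "0 < m" "real n \<le> 2 * m" using n by (auto simp: m_def of_nat_diff)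
  have lam0: "0 < lam"
  proof -
    have "0 < 24 / r * sqrt L" using r L0 by simp
    then have "0 < lam * (\<rho> * sqrt (real n))" using lam by linarith
    moreover have "0 < \<rho> * sqrt (real n)" using rho n by simp
    ultimately show ?thesis by (rule zero_less_mult_pos2)
  qed
  have rm: "162 * L \<le> r\<^sup>2 * (\<rho> * m)"
  proof -
    have "324 * L \<le> r\<^sup>2 * (\<rho> * real n)" using size r2 by (simp add: pos_divide_le_eq mult.commute)
    also have "\<dots> \<le> r\<^sup>2 * (\<rho> * (2 * m))" using m rho by (intro mult_left_mono) auto
    finally show ?thesis by (simp add: mult_ac)
  qed
  have lm: "288 * L \<le> r\<^sup>2 * (lam\<^sup>2 * \<rho>\<^sup>2 * m)"
  proof -
    have "24 * sqrt L \<le> r * (lam * (\<rho> * sqrt (real n)))" using lam r by (simp add: field_simps)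
    then have "(24 * sqrt L)\<^sup>2 \<le> (r * (lam * (\<rho> * sqrt (real n))))\<^sup>2" using L0 by (intro power_mono) auto
    then have "576 * L \<le> r\<^sup>2 * (lam\<^sup>2 * \<rho>\<^sup>2 * real n)"
      using L0 by (simp add: power_mult_distrib mult.assoc)
    also have "\<dots> \<le> r\<^sup>2 * (lam\<^sup>2 * \<rho>\<^sup>2 * (2 * m))" using m by (intro mult_left_mono) auto
    finally show ?thesis by (simp add: mult_ac)
  qed
  have s2: "s\<^sup>2 \<le> 100 * (real k + 1)\<^sup>2 / r\<^sup>2"
  proof -
    have "(10 * real k + 8)\<^sup>2 \<le> (10 * (real k + 1))\<^sup>2" by (intro power_mono) auto
    also have "\<dots> = 100 * (real k + 1)\<^sup>2" unfolding power_mult_distrib by simp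
    finally show ?thesis unfolding s_def power_divide by (rule divide_right_mono) simp
  qed
  \<comment> \<open>One criterion for both halves of the budget: 100 (k+1)^2 = 50 * 2(k+1) * (k+1),
    and 2(k+1) is at most \<open>L\<close>.\<close>
  have quot: "s\<^sup>2 / q \<le> real k + 1" if q: "50 * L \<le> r\<^sup>2 * q" for q
  proof -
    have "0 < r\<^sup>2 * q" using q L0 by linarith
    then have q0: "0 < q" using r2(1) by (rule zero_less_mult_pos)
    have "100 * (real k + 1)\<^sup>2 = 50 * (2 * (real k + 1)) * (real k + 1)" by algebra
    also have "\<dots> \<le> 50 * L * (real k + 1)" using L by (intro mult_right_mono mult_left_mono) auto
    also have "\<dots> \<le> r\<^sup>2 * q * (real k + 1)" using q by (intro mult_right_mono) auto
    finally have "100 * (real k + 1)\<^sup>2 / r\<^sup>2 \<le> q * (real k + 1)"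
      using r2 by (simp add: pos_divide_le_eq mult_ac)
    then have "s\<^sup>2 \<le> q * (real k + 1)" using s2 by linarith
    then show ?thesis using q0 by (simp add: pos_divide_le_eq mult.commute)
  qed
  have e1: "s\<^sup>2 / (\<rho> * m) \<le> real k + 1" by (rule quot) (use rm L0 in linarith)
  have e2: "s\<^sup>2 / (2 * (lam\<^sup>2 * \<rho>\<^sup>2 * m)) \<le> real k + 1" by (rule quot) (use lm L0 in linarith)
  have B: "2 * exp (s\<^sup>2 / (\<rho> * m) + s\<^sup>2 / (2 * (lam\<^sup>2 * \<rho>\<^sup>2 * m))) \<le> 2 * exp (2 * real k + 2)"
    using e1 e2 by simp
  have s0: "0 < s" using r by (simp add: s_def)
  have sb: "\<bar>s\<bar> \<le> \<rho> * m"
  proof -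
    have "s * r\<^sup>2 = (10 * real k + 8) * r" using r by (simp add: s_def power2_eq_square)
    also have "\<dots> \<le> (10 * real k + 8) * 1" using r by (intro mult_left_mono) auto
    also have "\<dots> \<le> 162 * L" using L by simp
    also have "\<dots> \<le> (\<rho> * m) * r\<^sup>2" using rm by (simp add: mult.commute)
    finally have "s \<le> \<rho> * m" using r2 by simp
    then show ?thesis using s0 by simp
  qed
  let ?t = "\<lambda>Y :: nat \<times> nat \<Rightarrow> real. \<Sum>j\<in>{1..<n}. 1 / (lam * \<rho> * real (n - 1)) * Y (0, j)"
  note mgf = row_statistic_mgf[OF rho n lam0]
  show ?thesis
  proof (rule MMSE_upper_bound_mgf[OF _ r s_def, where t = ?t])
    show "?t \<in> fspan (monomial_basis n 1)"
      by (intro fspan_sum fspan.scale monomial_span_coord) auto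
    show "integrable (planted_space n \<rho>) (\<lambda>\<omega>. exp (s * (?t (Yobs lam \<omega>) - of_bool (fst \<omega> 0))))"
      by (rule mgf(1)) (use sb in \<open>simp add: m_def\<close>)
    show "integrable (planted_space n \<rho>) (\<lambda>\<omega>. exp (- s * (?t (Yobs lam \<omega>) - of_bool (fst \<omega> 0))))"
      by (rule mgf(1)) (use sb in \<open>simp add: m_def\<close>)
    show "(\<integral>\<omega>. exp (s * (?t (Yobs lam \<omega>) - of_bool (fst \<omega> 0))) \<partial>planted_space n \<rho>) \<le> 2 * exp (2 * real k + 2)"
      by (rule order_trans[OF mgf(2)]) (use sb B in \<open>simp_all add: m_def\<close>)
    show "(\<integral>\<omega>. exp (- s * (?t (Yobs lam \<omega>) - of_bool (fst \<omega> 0))) \<partial>planted_space n \<rho>) \<le> 2 * exp (2 * real k + 2)"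
      by (rule order_trans[OF mgf(2)]) (use sb B in \<open>simp_all add: m_def\<close>)
  qed
qed

lemma MMSE_upper_bound:
  assumes rho: "0 < \<rho>" "\<rho> \<le> 1 / 2" and n: "n \<ge> 1" and r: "0 < r" "r < 1" and D: "odd D"
    and lam: "24 / r * sqrt (ln 8 + 2 * real D * ln (9 / \<rho>)) * min 1 (1 / (\<rho> * sqrt (real n))) \<le> lam"
    and size: "324 / (r\<^sup>2 * real n) * (ln 8 + 2 * real D * ln (9 / \<rho>)) \<le> \<rho>"
  shows "MMSE n lam \<rho> D \<le> ennreal (real D ^ 2 * r ^ (D - 1))"
proof -
  obtain k where k: "D = 2 * k + 1" using D by (auto elim: oddE)
  define L where "L = ln 8 + 2 * real D * ln (9 / \<rho>)"
  \<comment> \<open>This gives a logarithm of at least 1, hence \<open>L\<close> at least 2D = 4k +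
    2, and so the form \<open>2 * (real k + 1) \<le> L\<close> in which \<open>L\<close> enters both
    cases.\<close>
  have "exp 1 \<le> 9 / \<rho>"
  proof -
    have "3 \<le> 9 / \<rho>" using rho by (simp add: field_simps)
    then show ?thesis using exp_le by linarith
  qed
  then have "1 \<le> ln (9 / \<rho>)" using rho by (subst ln_ge_iff) auto
  then have "2 * real D * 1 \<le> 2 * real D * ln (9 / \<rho>)" by (intro mult_left_mono) auto
  moreover have "0 \<le> ln (8 :: real)" by simp
  ultimately have "2 * real D \<le> L" unfolding L_def by linarith
  then have L: "2 * (real k + 1) \<le> L" by (simp add: k)
  have sn: "0 < \<rho> * sqrt (real n)" using rho n by simp
  have "MMSE n lam \<rho> (2 * k + 1) \<le> ennreal (r ^ (2 * k))"
  \<comment> \<open>The minimum in the signal condition selects the statistic: the single diagonal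
    entry when it equals 1, the row sum otherwise.\<close>
  proof (cases "\<rho> * sqrt (real n) \<le> 1")
    case True
    then have "min 1 (1 / (\<rho> * sqrt (real n))) = 1" using sn by (simp add: min_def pos_le_divide_eq)
    then show ?thesis
      using MMSE_upper_bound_diagonal[OF rho(1) _ n r L] lam rho unfolding L_def by simp
  next
    case False
    then have "min 1 (1 / (\<rho> * sqrt (real n))) = 1 / (\<rho> * sqrt (real n))"
      using sn by (simp add: min_def pos_le_divide_eq)
    then have "24 / r * sqrt L \<le> lam * (\<rho> * sqrt (real n))"
      using lam sn unfolding L_def[symmetric] by (simp only: times_divide_eq_right mult_1_right pos_divide_le_eq)
    moreover have "324 * L / r\<^sup>2 \<le> \<rho> * real n"
    proof -
      have "324 * L / r\<^sup>2 = 324 / (r\<^sup>2 * real n) * L * real n" using n by simp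
      also have "\<dots> \<le> \<rho> * real n" using size unfolding L_def by (intro mult_right_mono) auto
      finally show ?thesis .
    qed
    ultimately show ?thesis using MMSE_upper_bound_row[OF rho(1) _ r L] rho by simp
  qed
  also have "\<dots> \<le> ennreal (real D ^ 2 * r ^ (D - 1))"
  proof (rule ennreal_leI)
    have "1 * r ^ (2 * k) \<le> real D ^ 2 * r ^ (2 * k)" using r by (intro mult_right_mono) (auto simp: k)
    then show "r ^ (2 * k) \<le> real D ^ 2 * r ^ (D - 1)" by (simp add: k)
  qed
  finally show ?thesis by (simp add: k)
qed

theorem mainTheorem2:
  fixes n :: nat and lam \<rho> :: real
  assumes "n \<ge> 1" and "lam \<ge> 0" and "0 < \<rho>" and "\<rho> < 1"
  shows "(\<forall>(r::real) (D::nat). 0 < r \<and> r < 1 \<and> D \<ge> 1 \<and>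
            lam \<le> r / (real D * (real D + 1)) * min 1 (1 / (\<rho> * sqrt (real n)))
          \<longrightarrow> MMSE n lam \<rho> D \<ge> ennreal (\<rho> - \<rho>\<^sup>2 / (1 - r\<^sup>2)\<^sup>2))
       \<and> (\<forall>(r::real) (D::nat). 0 < r \<and> r < 1 \<and> D \<ge> 1 \<and> odd D \<and>
            lam \<ge> 24 / r * sqrt (ln 8 + 2 * real D * ln (9 / \<rho>)) * min 1 (1 / (\<rho> * sqrt (real n))) \<and>
            324 / (r\<^sup>2 * real n) * (ln 8 + 2 * real D * ln (9 / \<rho>)) \<le> \<rho> \<and> \<rho> \<le> 1 / 2
          \<longrightarrow> MMSE n lam \<rho> D \<le> ennreal (real D ^ 2 * r ^ (D - 1)))"
  using MMSE_lower_bound[OF assms(3,4,1,2)] MMSE_upper_bound[OF assms(3) _ assms(1)] by blast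

end
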